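(* Let $n\ge1$ be an integer, let $p,q$ be odd primes with $q<p$, let $G$ be a group of the form $\mathbb{Z}_{p^n}\rtimes\mathbb{Z}_q$ (a semidirect product, possibly trivial), and let $N$ be a group of order $qp^n$. Then the pair $(G,N)$ is realizable if and only if $N$ is isomorphic to a semidirect product of the form $\mathbb{Z}_{p^n}\rtimes\mathbb{Z}_q$. Likewise, the pair $(N,G)$ is realizable if and only if $N$ is isomorphic to a semidirect product of the form $\mathbb{Z}_{p^n}\rtimes\mathbb{Z}_q$.
   Context: $\mathbb{Z}_m$ denotes the cyclic group of order $m$. For two finite groups $G,N$ of the same order, the pair $(G,N)$ is called realizable if there exists a Hopf-Galois structure of type $N$ on a Galois extension with Galois group $G$ (type $N$ for a Hopf algebra $\mathcal{H}$ acting on $L/K$ means $L\otimes_K\mathcal{H}\cong L[N]$ as $L$-Hopf algebras). Equivalently, the holomorph $\mathrm{Hol}(N)=N\rtimes\mathrm{Aut}(N)$, acting on $N$ by $(a,\zeta)\cdot b=a\,\zeta(b)$, has a subgroup isomorphic to $G$ that acts simply transitively on $N$; equivalently, there is a skew brace with multiplicative group isomorphic to $G$ and additive group isomorphic to $N$. *)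

theory Defs
  imports "HOL-Algebra.Algebra" "HOL-Computational_Algebra.Primes"
begin

definition semidirect_prod ::
    "('a, 'c) monoid_scheme \<Rightarrow> ('b, 'd) monoid_scheme \<Rightarrow> ('b \<Rightarrow> 'a \<Rightarrow> 'a) \<Rightarrow> ('a \<times> 'b) monoid"
  where "semidirect_prod A B \<theta> =
    \<lparr>carrier = carrier A \<times> carrier B,
     monoid.mult = (\<lambda>(a, x) (b, y). (a \<otimes>\<^bsub>A\<^esub> \<theta> x b, x \<otimes>\<^bsub>B\<^esub> y)),
     one = (\<one>\<^bsub>A\<^esub>, \<one>\<^bsub>B\<^esub>)\<rparr>"

text \<open>The homomorphism \<open>\<theta>\<close> is arbitrary; the trivial one gives the direct product.\<close>

definition is_cyclic_semidirect :: "nat \<Rightarrow> nat \<Rightarrow> ('a, 'c) monoid_scheme \<Rightarrow> bool"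
  where "is_cyclic_semidirect k m G \<longleftrightarrow>
    (\<exists>\<theta> \<in> hom (integer_mod_group m) (AutoGroup (integer_mod_group k)).
       G \<cong> semidirect_prod (integer_mod_group k) (integer_mod_group m) \<theta>)"

definition Holomorph :: "('a, 'c) monoid_scheme \<Rightarrow> ('a \<times> ('a \<Rightarrow> 'a)) monoid"
  where "Holomorph N = semidirect_prod N (AutoGroup N) (\<lambda>\<zeta>. \<zeta>)"

definition hol_action :: "('a, 'c) monoid_scheme \<Rightarrow> 'a \<times> ('a \<Rightarrow> 'a) \<Rightarrow> 'a \<Rightarrow> 'a"
  where "hol_action N = (\<lambda>(a, \<zeta>). \<lambda>b \<in> carrier N. a \<otimes>\<^bsub>N\<^esub> \<zeta> b)"

locale simply_transitive_action = group_action +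
  assumes simply_transitive: "\<lbrakk>x \<in> E; y \<in> E\<rbrakk> \<Longrightarrow> \<exists>!g. g \<in> carrier G \<and> \<phi> g x = y"

text \<open>
  \<open>realizable G N\<close>, for finite groups \<open>G\<close> and \<open>N\<close> of the same order: there is a Hopf-Galois
  structure of type \<open>N\<close> on a Galois extension with Galois group \<open>G\<close>. This is taken in the
  group-theoretic form due to Greither-Pareigis and Byott, namely that the holomorph of \<open>N\<close>
  has a subgroup isomorphic to \<open>G\<close> acting simply transitively on \<open>N\<close>.
\<close>

definition realizable :: "('a, 'c) monoid_scheme \<Rightarrow> ('b, 'd) monoid_scheme \<Rightarrow> bool"
  where "realizable G N \<longleftrightarrow>
    (\<exists>H. subgroup H (Holomorph N) \<and>
         G \<cong> (Holomorph N)\<lparr>carrier := H\<rparr> \<and>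
         simply_transitive_action ((Holomorph N)\<lparr>carrier := H\<rparr>) (carrier N) (hol_action N))"

lemma group_semidirect_prod:
  assumes "group A" "group B" and hom: "\<theta> \<in> hom B (AutoGroup A)"
  shows "group (semidirect_prod A B \<theta>)"
proof -
  interpret A: group A by fact
  interpret B: group B by fact
  have au: "\<theta> x \<in> auto A" if "x \<in> carrier B" for x
    using hom that by (auto simp: hom_def AutoGroup_def)
  have cl [simp]: "\<theta> x a \<in> carrier A" if "x \<in> carrier B" "a \<in> carrier A" for x a
    using au[OF that(1)] that(2) by (auto simp: auto_def hom_def)
  have mu: "\<theta> x (a \<otimes>\<^bsub>A\<^esub> b) = \<theta> x a \<otimes>\<^bsub>A\<^esub> \<theta> x b"
    if "x \<in> carrier B" "a \<in> carrier A" "b \<in> carrier A" for x a b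
    using au[OF that(1)] that by (auto simp: auto_def hom_def)
  have co: "\<theta> (x \<otimes>\<^bsub>B\<^esub> y) a = \<theta> x (\<theta> y a)"
    if "x \<in> carrier B" "y \<in> carrier B" "a \<in> carrier A" for x y a
    using hom au[OF that(1)] au[OF that(2)] that
    by (auto simp: hom_def AutoGroup_def BijGroup_def auto_def compose_def)
  have one: "\<theta> \<one>\<^bsub>B\<^esub> a = a" if "a \<in> carrier A" for a
    using hom_one[OF hom assms(2) A.AutoGroup] that
    by (simp add: AutoGroup_def BijGroup_def)
  show ?thesis
  proof (rule groupI)
    fix z assume "z \<in> carrier (semidirect_prod A B \<theta>)"
    then obtain a x where z: "z = (a, x)" "a \<in> carrier A" "x \<in> carrier B"
      by (auto simp: semidirect_prod_def)
    have "\<theta> (inv\<^bsub>B\<^esub> x) (inv\<^bsub>A\<^esub> a) \<otimes>\<^bsub>A\<^esub> \<theta> (inv\<^bsub>B\<^esub> x) a = \<one>\<^bsub>A\<^esub>"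
    proof -
      have "\<theta> (inv\<^bsub>B\<^esub> x) \<one>\<^bsub>A\<^esub> = \<one>\<^bsub>A\<^esub>"
        using mu[of "inv\<^bsub>B\<^esub> x" "\<one>\<^bsub>A\<^esub>" "\<one>\<^bsub>A\<^esub>"] z
        by (metis A.l_cancel_one' A.one_closed A.r_one B.inv_closed cl)
      then show ?thesis using mu[of "inv\<^bsub>B\<^esub> x" "inv\<^bsub>A\<^esub> a" a] z by simp
    qed
    then show "\<exists>y\<in>carrier (semidirect_prod A B \<theta>).
        y \<otimes>\<^bsub>semidirect_prod A B \<theta>\<^esub> z = \<one>\<^bsub>semidirect_prod A B \<theta>\<^esub>"
      using z by (intro bexI[of _ "(\<theta> (inv\<^bsub>B\<^esub> x) (inv\<^bsub>A\<^esub> a), inv\<^bsub>B\<^esub> x)"])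
        (auto simp: semidirect_prod_def)
  qed (auto simp: semidirect_prod_def mu co one A.m_assoc B.m_assoc)
qed

lemma group_Holomorph:
  assumes "group N" shows "group (Holomorph N)"
proof -
  have "(\<lambda>\<zeta>. \<zeta>) \<in> hom (AutoGroup N) (AutoGroup N)"
    by (auto simp: hom_def)
  then show ?thesis
    unfolding Holomorph_def
    using assms group.AutoGroup[OF assms] by (intro group_semidirect_prod)
qed

lemma hol_action_group_action:
  assumes "group N"
  shows "group_action (Holomorph N) (carrier N) (hol_action N)"
proof -
  interpret N: group N by fact
  have bij: "hol_action N (a, \<zeta>) \<in> Bij (carrier N)" if "a \<in> carrier N" "\<zeta> \<in> auto N" for a \<zeta>
  proof -
    have "bij_betw \<zeta> (carrier N) (carrier N)" using that by (auto simp: auto_def Bij_def)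
    moreover have "bij_betw (\<lambda>b. a \<otimes>\<^bsub>N\<^esub> b) (carrier N) (carrier N)"
      using that by (intro bij_betwI[where g = "\<lambda>b. inv\<^bsub>N\<^esub> a \<otimes>\<^bsub>N\<^esub> b"])
        (auto simp: N.m_assoc[symmetric])
    ultimately have "bij_betw (\<lambda>b. a \<otimes>\<^bsub>N\<^esub> \<zeta> b) (carrier N) (carrier N)"
      using bij_betw_trans by (fastforce simp: o_def)
    then show ?thesis
      by (auto simp: hol_action_def Bij_def cong: bij_betw_cong)
  qed
  have "hol_action N \<in> hom (Holomorph N) (BijGroup (carrier N))"
  proof (rule homI)
    fix z assume "z \<in> carrier (Holomorph N)"
    then show "hol_action N z \<in> carrier (BijGroup (carrier N))"
      using bij by (auto simp: Holomorph_def semidirect_prod_def AutoGroup_def BijGroup_def)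
  next
    fix z w assume "z \<in> carrier (Holomorph N)" "w \<in> carrier (Holomorph N)"
    then obtain a \<zeta> b \<eta> where zw: "z = (a, \<zeta>)" "w = (b, \<eta>)" "a \<in> carrier N" "b \<in> carrier N"
        "\<zeta> \<in> auto N" "\<eta> \<in> auto N"
      by (auto simp: Holomorph_def semidirect_prod_def AutoGroup_def)
    have cl: "\<zeta> c \<in> carrier N" "\<eta> c \<in> carrier N" if "c \<in> carrier N" for c
      using zw that by (auto simp: auto_def hom_def)
    have mu: "\<zeta> (c \<otimes>\<^bsub>N\<^esub> d) = \<zeta> c \<otimes>\<^bsub>N\<^esub> \<zeta> d" if "c \<in> carrier N" "d \<in> carrier N" for c d
      using zw that by (auto simp: auto_def hom_def)
    have B: "\<zeta> \<in> Bij (carrier N)" "\<eta> \<in> Bij (carrier N)" using zw by (auto simp: auto_def)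
    have "hol_action N (a \<otimes>\<^bsub>N\<^esub> \<zeta> b, compose (carrier N) \<zeta> \<eta>)
        = compose (carrier N) (hol_action N (a, \<zeta>)) (hol_action N (b, \<eta>))"
      using zw by (auto simp: hol_action_def compose_def cl mu N.m_assoc)
    then show "hol_action N (z \<otimes>\<^bsub>Holomorph N\<^esub> w)
        = hol_action N z \<otimes>\<^bsub>BijGroup (carrier N)\<^esub> hol_action N w"
      using zw B bij[of a \<zeta>] bij[of b \<eta>]
      by (simp add: Holomorph_def semidirect_prod_def AutoGroup_def BijGroup_def)
  qed
  then show ?thesis
    using group_Holomorph[OF assms] group_BijGroup
    by (simp add: group_action_def group_hom_def group_hom_axioms_def)
qed

end

theory Submission
  imports Defs "HOL-Number_Theory.Residues"
begin

text \<open>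
  Since \<open>q < p\<close>, the elements of \<open>p\<close>-power order form a characteristic Sylow subgroup of order
  \<open>p ^ n\<close> in any group of order \<open>q * p ^ n\<close>, and the group has the form \<open>Z(p ^ n) \<rtimes> Z(q)\<close> iff this Sylow
  subgroup is cyclic. A realization restricts to the Sylow subgroups, so the claim is that in a
  skew brace of order \<open>p ^ n\<close>, \<open>p\<close> odd, the additive group \<open>P\<close> is cyclic iff the multiplicative
  group \<open>Q\<close> is.

  If \<open>P = \<langle>c\<rangle>\<close>, an element \<open>g \<in> Q\<close> over \<open>c\<close> acts by \<open>x \<mapsto> c x\<^sup>u\<close> with \<open>u \<equiv> 1\<close> modulo \<open>p\<close>, and the
  \<open>p\<close>-adic valuation of \<open>1 + u + \<dots> + u\<^sup>k\<^sup>-\<^sup>1\<close> is that of \<open>k\<close>; hence \<open>g\<close> has order \<open>p ^ n\<close>.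

  If \<open>Q = \<langle>g\<rangle>\<close>, then \<open>P\<close> is a single orbit of an affine map \<open>y \<mapsto> a \<zeta>(y)\<close>. By induction \<open>P / C\<close> is
  generated by \<open>a\<close> for a central subgroup \<open>C\<close> of order \<open>p\<close> fixed by \<open>\<zeta>\<close>. Were \<open>P\<close> not cyclic, the
  orbit would close up after only \<open>ord a\<close> steps.
\<close>

subsection \<open>Geometric sums modulo prime powers\<close>

text \<open>Every binomial term beyond the linear one carries a factor
  \<open>p\<^sup>2\<close>.\<close>

lemma power_one_plus_cong:
  fixes p t :: nat
  shows "[(1 + p * t) ^ j = 1 + j * (p * t)] (mod p\<^sup>2)"
proof (induction j)
  case (Suc j)
  have "[(1 + p * t) ^ Suc j = (1 + p * t) * (1 + j * (p * t))] (mod p\<^sup>2)"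
    using Suc by (simp only: power_Suc) (intro cong_mult cong_refl)
  also have "(1 + p * t) * (1 + j * (p * t)) = 1 + Suc j * (p * t) + p\<^sup>2 * (j * t * t)"
    by (simp add: algebra_simps power2_eq_square)
  also have "[\<dots> = 1 + Suc j * (p * t)] (mod p\<^sup>2)"
    by (simp add: cong_def)
  finally show ?case .
qed simp

text \<open>The factor \<open>p\<close> is split off because oddness enters only through the
  divisibility of this sum by \<open>p\<close>; it is applied to \<open>p\<close> itself and to
  powers of \<open>p\<close>.\<close>

lemma odd_sum_lessThan: "odd p \<Longrightarrow> (\<Sum>j<p. j) = p * ((p - 1) div 2)" for p :: nat
proof -
  assume "odd p"
  then obtain m where "p = 2 * m + 1" by (auto elim: oddE)
  moreover have "2 * (\<Sum>j<p. j) = p * (p - 1)" for p :: nat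
    by (induction p) (auto simp: algebra_simps diff_mult_distrib2)
  ultimately show ?thesis by (metis add_diff_cancel_right' mult.left_commute
        nonzero_mult_div_cancel_left zero_neq_numeral)
qed

text \<open>With \<open>w = 1 + p * t\<close>, the linear terms add up to \<open>p * t\<close> times
  \<open>0 + ... + (p - 1)\<close>, which is a multiple of \<open>p\<^sup>2\<close> for odd
  \<open>p\<close>. For \<open>p = 2\<close> and \<open>w = 3\<close> the sum is 4, which is not
  congruent to 2 modulo 4.\<close>

lemma geometric_sum_cong:
  fixes p w :: nat
  assumes "odd p" "[w = 1] (mod p)" "1 < p"
  shows "[(\<Sum>j<p. w ^ j) = p] (mod p\<^sup>2)"
proof -
  have "w mod p = 1" using assms by (simp add: cong_def)
  then have w: "w = 1 + p * (w div p)" by (metis add.commute mult_div_mod_eq)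
  define t where "t = w div p"
  have "[(\<Sum>j<p. w ^ j) = (\<Sum>j<p. 1 + j * (p * t))] (mod p\<^sup>2)"
    using power_one_plus_cong[of p t] w unfolding t_def by (intro cong_sum) metis
  also have "(\<Sum>j<p. 1 + j * (p * t)) = p + p\<^sup>2 * (((p - 1) div 2) * t)"
    unfolding sum.distrib by (simp flip: sum_distrib_right add: odd_sum_lessThan[OF assms(1)] power2_eq_square)
  also have "[\<dots> = p] (mod p\<^sup>2)" by (simp add: cong_def)
  finally show ?thesis .
qed

text \<open>The valuation of the sum is exactly \<open>k\<close>. Passing from \<open>k\<close> to
  \<open>Suc k\<close> multiplies the sum by a geometric sum of \<open>p\<close> terms in
  \<open>u ^ (p ^ k)\<close>, which contributes exactly one factor \<open>p\<close>. No division by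
  \<open>u - 1\<close> occurs, so \<open>u = 1\<close> is covered.\<close>

lemma geometric_sum_prime_power:
  fixes p u :: nat
  assumes "Factorial_Ring.prime p" "odd p" "[u = 1] (mod p)"
  shows "p ^ k dvd (\<Sum>i<p ^ k. u ^ i)" "\<not> p ^ Suc k dvd (\<Sum>i<p ^ k. u ^ i)"
proof -
  have p: "1 < p" using assms(1) by (rule prime_gt_1_nat)
  have "\<exists>m. (\<Sum>i<p ^ k. u ^ i) = p ^ k * m \<and> \<not> p dvd m"
  proof (induction k)
    case 0
    then show ?case using p by simp
  next
    case (Suc k)
    then obtain m where m: "(\<Sum>i<p ^ k. u ^ i) = p ^ k * m" "\<not> p dvd m" by blast
    define w where "w = u ^ (p ^ k)"
    have "[w = 1 ^ (p ^ k)] (mod p)" unfolding w_def using assms(3) by (rule cong_pow)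
    then have "[(\<Sum>j<p. w ^ j) = p] (mod p\<^sup>2)" using geometric_sum_cong assms(2) p by simp
    then obtain r where r: "(\<Sum>j<p. w ^ j) = p * r" "\<not> p dvd r"
    proof -
      assume a: "[(\<Sum>j<p. w ^ j) = p] (mod p\<^sup>2)"
      then have "p dvd (\<Sum>j<p. w ^ j)"
        by (metis cong_dvd_iff cong_dvd_modulus_nat dvd_refl dvd_triv_left power2_eq_square)
      then obtain r where r: "(\<Sum>j<p. w ^ j) = p * r" by blast
      have "\<not> p dvd r"
      proof
        assume "p dvd r"
        then have "p\<^sup>2 dvd (\<Sum>j<p. w ^ j)" unfolding r power2_eq_square by (rule mult_dvd_mono[OF dvd_refl])
        then have "p\<^sup>2 dvd p" using a cong_dvd_iff by blast
        then show False using p by (auto dest!: dvd_imp_le simp: power2_eq_square)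
      qed
      with r show thesis by (rule that)
    qed
    \<comment> \<open>The exponents are cut into \<open>p\<close> consecutive blocks of length
      \<open>p ^ k\<close>; block \<open>j\<close> is \<open>w ^ j\<close> times the first
      block.\<close>
    have "(\<Sum>i<p ^ Suc k. u ^ i) = (\<Sum>j<p. \<Sum>i = j * p ^ k..<j * p ^ k + p ^ k. u ^ i)"
      by (simp add: sum.nat_group)
    also have "\<dots> = (\<Sum>j<p. \<Sum>i<p ^ k. w ^ j * u ^ i)"
    proof (rule sum.cong[OF refl])
      fix j
      have "(\<Sum>i = j * p ^ k..<j * p ^ k + p ^ k. u ^ i) = (\<Sum>i = 0..<p ^ k. u ^ (i + j * p ^ k))"
        using sum.shift_bounds_nat_ivl[of "\<lambda>i. u ^ i" 0 "j * p ^ k" "p ^ k"] by (simp add: add.commute)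
      also have "\<dots> = (\<Sum>i<p ^ k. w ^ j * u ^ i)"
        unfolding w_def by (simp add: power_add power_mult mult.commute lessThan_atLeast0 flip: power_mult)
      finally show "(\<Sum>i = j * p ^ k..<j * p ^ k + p ^ k. u ^ i) = (\<Sum>i<p ^ k. w ^ j * u ^ i)" .
    qed
    also have "\<dots> = p ^ Suc k * (r * m)"
      by (simp flip: sum_distrib_left sum_distrib_right add: r(1) m(1) mult_ac)
    finally have "(\<Sum>i<p ^ Suc k. u ^ i) = p ^ Suc k * (r * m)" .
    moreover have "\<not> p dvd r * m" using r(2) m(2) assms(1) by (simp add: prime_dvd_mult_iff)
    ultimately show ?case by blast
  qed
  then obtain m where m: "(\<Sum>i<p ^ k. u ^ i) = p ^ k * m" "\<not> p dvd m" by blast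
  show "p ^ k dvd (\<Sum>i<p ^ k. u ^ i)" "\<not> p ^ Suc k dvd (\<Sum>i<p ^ k. u ^ i)"
    unfolding m(1) using m(2) p by (simp_all add: mult.commute[of p])
qed

text \<open>Iterated Fermat, including multiples of \<open>p\<close>. It serves to deduce
  \<open>u = 1\<close> modulo \<open>p\<close> when a map of \<open>p\<close>-power period raises an
  element to the power \<open>u\<close>.\<close>

lemma cong_power_prime_power:
  fixes p u :: nat
  assumes "Factorial_Ring.prime p" shows "[u ^ p ^ k = u] (mod p)"
proof (induction k)
  case (Suc k)
  have fermat: "[v ^ p = v] (mod p)" for v :: nat
  proof (cases "p dvd v")
    case True
    then show ?thesis using prime_gt_0_nat[OF assms] by (simp add: cong_def mod_0_imp_dvd dvd_imp_mod_0 dvd_power dvd_trans[OF _ dvd_power])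
  next
    case False
    then have "[v ^ (p - 1) * v = 1 * v] (mod p)"
      by (intro cong_mult cong_refl fermat_theorem assms)
    then show ?thesis using prime_gt_0_nat[OF assms] by (simp flip: power_Suc2)
  qed
  show ?case using fermat[of "u ^ p ^ k"] Suc cong_trans by (auto simp: power_mult[symmetric] mult.commute)
qed simp

subsection \<open>Regular subgroups of the holomorph\<close>

text \<open>A realization of \<open>(G, N)\<close> amounts to a skew brace: the regular subgroup of the holomorph is
  \<open>{(\<beta> g, \<gamma> g) | g \<in> G}\<close>, with \<open>\<beta> g\<close> the image of the identity under \<open>g\<close>.\<close>

locale bijective_cocycle = G: group G + N: group N
  for G :: "('a, 'c) monoid_scheme" (structure) and N :: "('b, 'd) monoid_scheme"
  and \<beta> :: "'a \<Rightarrow> 'b" and \<gamma> :: "'a \<Rightarrow> 'b \<Rightarrow> 'b" +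
  assumes bij: "bij_betw \<beta> (carrier G) (carrier N)"
    and \<gamma>_auto: "g \<in> carrier G \<Longrightarrow> \<gamma> g \<in> auto N"
    and \<beta>_mult: "\<lbrakk>g \<in> carrier G; h \<in> carrier G\<rbrakk> \<Longrightarrow> \<beta> (g \<otimes> h) = \<beta> g \<otimes>\<^bsub>N\<^esub> \<gamma> g (\<beta> h)"
begin

lemma \<beta>_closed [simp]: "g \<in> carrier G \<Longrightarrow> \<beta> g \<in> carrier N"
  using bij by (auto simp: bij_betw_def)

lemma \<beta>_surj:
  assumes "x \<in> carrier N" obtains g where "g \<in> carrier G" "x = \<beta> g"
  using assms unfolding bij_betw_imp_surj_on[OF bij, symmetric] by blast

lemma \<gamma>_Bij: "g \<in> carrier G \<Longrightarrow> \<gamma> g \<in> Bij (carrier N)"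
  and \<gamma>_hom: "g \<in> carrier G \<Longrightarrow> \<gamma> g \<in> hom N N"
  using \<gamma>_auto by (auto simp: auto_def)

lemma \<gamma>_closed [simp]: "\<lbrakk>g \<in> carrier G; x \<in> carrier N\<rbrakk> \<Longrightarrow> \<gamma> g x \<in> carrier N"
  using \<gamma>_hom by (auto simp: hom_def)

lemma \<gamma>_mult:
  "\<lbrakk>g \<in> carrier G; x \<in> carrier N; y \<in> carrier N\<rbrakk> \<Longrightarrow> \<gamma> g (x \<otimes>\<^bsub>N\<^esub> y) = \<gamma> g x \<otimes>\<^bsub>N\<^esub> \<gamma> g y"
  using \<gamma>_hom by (auto simp: hom_def)

lemma \<gamma>_pow:
  "\<lbrakk>g \<in> carrier G; x \<in> carrier N\<rbrakk> \<Longrightarrow> \<gamma> g (x [^]\<^bsub>N\<^esub> (k::nat)) = \<gamma> g x [^]\<^bsub>N\<^esub> k"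
  using hom_nat_pow[OF \<gamma>_hom] by (simp add: N.is_group)

lemma \<gamma>_one [simp]: "g \<in> carrier G \<Longrightarrow> \<gamma> g \<one>\<^bsub>N\<^esub> = \<one>\<^bsub>N\<^esub>"
  using hom_one[OF \<gamma>_hom] by (simp add: N.is_group)

text \<open>Write \<open>x = \<beta> k\<close>, expand \<open>\<beta>\<close> on the two bracketings
  of the product of \<open>g\<close>, \<open>h\<close>, \<open>k\<close>, and cancel in
  \<open>N\<close>: the action law follows from the cocycle identity.\<close>

lemma \<gamma>_comp:
  assumes "g \<in> carrier G" "h \<in> carrier G" "x \<in> carrier N"
  shows "\<gamma> (g \<otimes> h) x = \<gamma> g (\<gamma> h x)"
proof -
  obtain k where k: "k \<in> carrier G" "x = \<beta> k" using \<beta>_surj assms(3) by blast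
  have "\<beta> ((g \<otimes> h) \<otimes> k) = \<beta> (g \<otimes> (h \<otimes> k))" using assms k by (simp add: G.m_assoc)
  then have "\<beta> (g \<otimes> h) \<otimes>\<^bsub>N\<^esub> \<gamma> (g \<otimes> h) x = \<beta> (g \<otimes> h) \<otimes>\<^bsub>N\<^esub> \<gamma> g (\<gamma> h x)"
    using assms k by (simp add: \<beta>_mult \<gamma>_mult N.m_assoc)
  then show ?thesis using assms by simp
qed

lemma \<beta>_one [simp]: "\<beta> \<one> = \<one>\<^bsub>N\<^esub>"
proof -
  have "\<gamma> \<one> (\<beta> \<one>) = \<gamma> \<one> \<one>\<^bsub>N\<^esub>" using \<beta>_mult[OF G.one_closed G.one_closed] by simp
  moreover have "inj_on (\<gamma> \<one>) (carrier N)"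
    using \<gamma>_Bij[OF G.one_closed] by (auto simp: Bij_def bij_betw_def)
  ultimately show ?thesis using inj_onD[of "\<gamma> \<one>"] by simp
qed

lemma \<gamma>_at_one: "x \<in> carrier N \<Longrightarrow> \<gamma> \<one> x = x"
  using \<beta>_mult[OF G.one_closed] by (elim \<beta>_surj) simp

lemma \<gamma>_nat_pow:
  assumes "g \<in> carrier G" "x \<in> carrier N"
  shows "\<gamma> (g [^] (k::nat)) x = (\<gamma> g ^^ k) x"
proof (induction k)
  case (Suc k)
  have "\<gamma> (g [^] Suc k) x = \<gamma> (g \<otimes> g [^] k) x" using G.nat_pow_Suc2[OF assms(1)] by simp
  then show ?case using assms Suc by (simp add: \<gamma>_comp)
qed (use assms \<gamma>_at_one in simp)

text \<open>The powers of \<open>g\<close> trace the orbit of the identity under an affine map of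
  \<open>N\<close>; through this, cyclicity on the side of \<open>G\<close> becomes a statement
  about a single orbit.\<close>

lemma \<beta>_nat_pow:
  assumes "g \<in> carrier G"
  shows "\<beta> (g [^] (k::nat)) = ((\<lambda>y. \<beta> g \<otimes>\<^bsub>N\<^esub> \<gamma> g y) ^^ k) \<one>\<^bsub>N\<^esub>"
proof (induction k)
  case (Suc k)
  have "\<beta> (g [^] Suc k) = \<beta> (g \<otimes> g [^] k)" using G.nat_pow_Suc2[OF assms] by simp
  then show ?case using assms Suc by (simp add: \<beta>_mult)
qed simp

text \<open>In skew brace terms an invariant subgroup is a left ideal, hence also a subgroup for the
  other operation. It is applied to the Sylow \<open>p\<close>-subgroup of \<open>N\<close>.\<close>

lemma subgroup_\<beta>_vimage:
  assumes "subgroup P N" and inv: "\<And>g x. g \<in> carrier G \<Longrightarrow> x \<in> P \<Longrightarrow> \<gamma> g x \<in> P"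
  shows "subgroup {g \<in> carrier G. \<beta> g \<in> P} G" "card {g \<in> carrier G. \<beta> g \<in> P} = card P"
proof -
  let ?Q = "{g \<in> carrier G. \<beta> g \<in> P}"
  interpret P: subgroup P N by fact
  show "subgroup ?Q G"
  proof (rule G.subgroupI)
    have "\<one> \<in> ?Q" by simp
    then show "?Q \<noteq> {}" by blast
    show "g \<otimes> h \<in> ?Q" if "g \<in> ?Q" "h \<in> ?Q" for g h
      using that inv by (simp add: \<beta>_mult)
    show "inv g \<in> ?Q" if "g \<in> ?Q" for g
    proof -
      have g: "g \<in> carrier G" "\<beta> g \<in> P" using that by auto
      \<comment> \<open>The cocycle identity at \<open>g\<close> and \<open>inv g\<close> identifies
        \<open>\<gamma> g (\<beta> (inv g))\<close> with an element of \<open>P\<close>; applying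
        \<open>\<gamma> (inv g)\<close> undoes \<open>\<gamma> g\<close> and stays in
        \<open>P\<close>.\<close>
      have "\<beta> g \<otimes>\<^bsub>N\<^esub> \<gamma> g (\<beta> (inv g)) = \<one>\<^bsub>N\<^esub>" using g \<beta>_mult[of g "inv g"] by simp
      then have "inv\<^bsub>N\<^esub> \<beta> g \<otimes>\<^bsub>N\<^esub> (\<beta> g \<otimes>\<^bsub>N\<^esub> \<gamma> g (\<beta> (inv g))) = inv\<^bsub>N\<^esub> \<beta> g" using g by simp
      then have "\<gamma> g (\<beta> (inv g)) = inv\<^bsub>N\<^esub> \<beta> g" using g by (simp flip: N.m_assoc)
      then have "\<gamma> (inv g) (\<gamma> g (\<beta> (inv g))) \<in> P" using g by (simp add: inv)
      moreover have "\<gamma> (inv g) (\<gamma> g (\<beta> (inv g))) = \<beta> (inv g)"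
        using g by (simp add: \<gamma>_at_one flip: \<gamma>_comp)
      ultimately show ?thesis using g by simp
    qed
  qed auto
  have "\<beta> ` ?Q = P"
  proof
    show "P \<subseteq> \<beta> ` ?Q"
    proof
      fix x assume "x \<in> P"
      then obtain g where "g \<in> carrier G" "x = \<beta> g" using \<beta>_surj P.mem_carrier by blast
      then show "x \<in> \<beta> ` ?Q" using \<open>x \<in> P\<close> by blast
    qed
  qed blast
  moreover have "inj_on \<beta> ?Q" using bij by (auto simp: bij_betw_def inj_on_def)
  ultimately show "card ?Q = card P" using card_image[of \<beta> ?Q] by simp
qed

end

section \<open>Realizations as bijective cocycles, and their transport along isomorphisms\<close>

lemma realizable_iff_bijective_cocycle:
  fixes G :: "('a, 'c) monoid_scheme" and N :: "('b, 'd) monoid_scheme"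
  assumes "group G" "group N"
  shows "realizable G N \<longleftrightarrow> (\<exists>\<beta> \<gamma>. bijective_cocycle G N \<beta> \<gamma>)"
proof
  interpret G: group G by fact
  interpret N: group N by fact
  let ?Hol = "Holomorph N"
  assume "realizable G N"
  then obtain H where H: "subgroup H ?Hol" "G \<cong> ?Hol\<lparr>carrier := H\<rparr>"
    "simply_transitive_action (?Hol\<lparr>carrier := H\<rparr>) (carrier N) (hol_action N)"
    unfolding realizable_def by blast
  obtain h where h: "h \<in> hom G (?Hol\<lparr>carrier := H\<rparr>)" "bij_betw h (carrier G) H"
    using H(2) by (auto simp: is_iso_def iso_def)
  have hH: "h g \<in> H" if "g \<in> carrier G" for g using h(2) that by (auto simp: bij_betw_def)
  have HN: "fst z \<in> carrier N" "snd z \<in> auto N" if "z \<in> H" for z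
    using subgroup.subset[OF H(1)] that
    by (auto simp: Holomorph_def semidirect_prod_def AutoGroup_def)
  have one: "\<zeta> \<one>\<^bsub>N\<^esub> = \<one>\<^bsub>N\<^esub>" if "\<zeta> \<in> auto N" for \<zeta>
    using that hom_one[OF _ assms(2,2)] by (auto simp: auto_def)
  have act: "hol_action N z \<one>\<^bsub>N\<^esub> = fst z" if "z \<in> H" for z
    using HN[OF that] one[OF HN(2)[OF that]] by (simp add: hol_action_def case_prod_beta)
  \<comment> \<open>Simple transitivity at the base point: \<open>z\<close> moves the identity of
    \<open>N\<close> to \<open>fst z\<close>, so the first projection is a bijection from
    \<open>H\<close> to \<open>N\<close>.\<close>
  have "\<exists>!z. z \<in> H \<and> fst z = y" if "y \<in> carrier N" for y
    using simply_transitive_action.simply_transitive[OF H(3) N.one_closed that] act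
    by (simp cong: conj_cong)
  then have "bij_betw fst H (carrier N)"
    using HN(1) unfolding bij_betw_def inj_on_def by (auto simp: image_iff) (metis fst_conv)+
  then have "bij_betw (fst \<circ> h) (carrier G) (carrier N)"
    using h(2) bij_betw_trans by blast
  moreover have "(fst \<circ> h) (g \<otimes>\<^bsub>G\<^esub> k) = (fst \<circ> h) g \<otimes>\<^bsub>N\<^esub> (snd \<circ> h) g ((fst \<circ> h) k)"
    if "g \<in> carrier G" "k \<in> carrier G" for g k
    using hom_mult[OF h(1) that]
    by (auto simp: Holomorph_def semidirect_prod_def split: prod.splits)
  ultimately have "bijective_cocycle G N (fst \<circ> h) (snd \<circ> h)"
    using HN(2) hH by unfold_locales auto
  then show "\<exists>\<beta> \<gamma>. bijective_cocycle G N \<beta> \<gamma>" by blast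
next
  let ?Hol = "Holomorph N"
  assume "\<exists>\<beta> \<gamma>. bijective_cocycle G N \<beta> \<gamma>"
  then obtain \<beta> \<gamma> where "bijective_cocycle G N \<beta> \<gamma>" by blast
  then interpret bijective_cocycle G N \<beta> \<gamma> .
  \<comment> \<open>Elements of the automorphism group are functions undefined outside the carrier,
    so the pointwise law has to be lifted to an equality of extensional functions.\<close>
  have \<gamma>_compose: "\<gamma> (g \<otimes>\<^bsub>G\<^esub> h) = compose (carrier N) (\<gamma> g) (\<gamma> h)"
    if gh: "g \<in> carrier G" "h \<in> carrier G" for g h
  proof (rule extensionalityI[of _ "carrier N"])
    show "\<gamma> (g \<otimes>\<^bsub>G\<^esub> h) \<in> extensional (carrier N)" using \<gamma>_Bij gh by (auto simp: Bij_def)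
  qed (use gh \<gamma>_comp in \<open>auto simp: compose_def\<close>)
  define h where "h g = (\<beta> g, \<gamma> g)" for g
  have hom: "h \<in> hom G ?Hol"
    by (rule homI) (auto simp: h_def Holomorph_def semidirect_prod_def AutoGroup_def BijGroup_def
        \<gamma>_auto \<beta>_mult \<gamma>_compose \<gamma>_Bij)
  interpret h: group_hom G ?Hol h
    using hom group_Holomorph[OF assms(2)] assms(1) by (simp add: group_hom_def group_hom_axioms_def)
  let ?H = "h ` carrier G"
  have sub: "subgroup ?H ?Hol" by (rule h.img_is_subgroup)
  have "inj_on h (carrier G)" using bij by (auto simp: h_def bij_betw_def inj_on_def)
  then have "h \<in> iso G (?Hol\<lparr>carrier := ?H\<rparr>)"
    using hom by (auto simp: iso_def hom_def bij_betw_def)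
  then have iso: "G \<cong> ?Hol\<lparr>carrier := ?H\<rparr>" by (rule is_isoI)
  interpret act: group_action ?Hol "carrier N" "hol_action N"
    by (rule hol_action_group_action[OF assms(2)])
  interpret actH: group_action "?Hol\<lparr>carrier := ?H\<rparr>" "carrier N" "hol_action N"
    by (rule act.induced_action[OF sub])
  \<comment> \<open>The unique element that moves \<open>\<beta> k\<close> to
    \<open>\<beta> l\<close> comes from \<open>l\<close> times the inverse of
    \<open>k\<close>.\<close>
  have "\<exists>!z. z \<in> ?H \<and> hol_action N z x = y" if xy: "x \<in> carrier N" "y \<in> carrier N" for x y
  proof -
    obtain k l where k: "k \<in> carrier G" "x = \<beta> k" "l \<in> carrier G" "y = \<beta> l"
      using xy by (meson \<beta>_surj)
    have "hol_action N (h g) x = \<beta> (g \<otimes>\<^bsub>G\<^esub> k)" if "g \<in> carrier G" for g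
      using that k by (simp add: h_def hol_action_def \<beta>_mult)
    moreover have "\<beta> (g \<otimes>\<^bsub>G\<^esub> k) = \<beta> l \<longleftrightarrow> g = l \<otimes>\<^bsub>G\<^esub> inv\<^bsub>G\<^esub> k" if "g \<in> carrier G" for g
      using bij k that by (metis (no_types, lifting) G.inv_closed G.inv_solve_right G.m_closed
          bij_betw_imp_inj_on inj_on_eq_iff)
    ultimately show ?thesis
      using k by (intro ex1I[of _ "h (l \<otimes>\<^bsub>G\<^esub> inv\<^bsub>G\<^esub> k)"])
        (auto simp del: h.hom_mult h.hom_inv)
  qed
  then have "simply_transitive_action (?Hol\<lparr>carrier := ?H\<rparr>) (carrier N) (hol_action N)"
    by unfold_locales simp
  then show "realizable G N" unfolding realizable_def using sub iso by blast
qed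

text \<open>The cocycle is composed with the isomorphisms. This reduces constructions to concrete
  semidirect products.\<close>

lemma realizable_iso:
  assumes "group G" "group N" "group G'" "group N'"
    and "realizable G N" "G \<cong> G'" "N \<cong> N'"
  shows "realizable G' N'"
proof -
  obtain \<beta> \<gamma> where "bijective_cocycle G N \<beta> \<gamma>"
    using assms by (auto simp: realizable_iff_bijective_cocycle)
  then interpret bijective_cocycle G N \<beta> \<gamma> .
  interpret G': group G' by fact
  interpret N': group N' by fact
  obtain i where i: "i \<in> iso G' G" using G.iso_sym[OF assms(6)] by (auto simp: is_iso_def)
  obtain j j' where j: "group_isomorphisms N N' j j'"
    using assms(7) group.iso_iff_group_isomorphisms[OF assms(2)] unfolding is_iso_def by blast
  have icl: "i g \<in> carrier G" if "g \<in> carrier G'" for g using i that by (auto simp: iso_def hom_def)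
  have jcl [simp]: "j x \<in> carrier N'" if "x \<in> carrier N" for x
    using j that by (auto simp: group_isomorphisms_def hom_def)
  have j'cl [simp]: "j' x \<in> carrier N" if "x \<in> carrier N'" for x
    using j that by (auto simp: group_isomorphisms_def hom_def)
  have jj' [simp]: "j (j' x) = x" if "x \<in> carrier N'" for x
    using j that by (auto simp: group_isomorphisms_def)
  have j'j [simp]: "j' (j x) = x" if "x \<in> carrier N" for x
    using j that by (auto simp: group_isomorphisms_def)
  have jmult: "j (x \<otimes>\<^bsub>N\<^esub> y) = j x \<otimes>\<^bsub>N'\<^esub> j y" if "x \<in> carrier N" "y \<in> carrier N" for x y
    using j that by (auto simp: group_isomorphisms_def hom_def)
  have j'mult: "j' (x \<otimes>\<^bsub>N'\<^esub> y) = j' x \<otimes>\<^bsub>N\<^esub> j' y" if "x \<in> carrier N'" "y \<in> carrier N'" for x y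
    using j that by (auto simp: group_isomorphisms_def hom_def)
  have jbij: "bij_betw j (carrier N) (carrier N')" and j'bij: "bij_betw j' (carrier N') (carrier N)"
    by (auto intro: bij_betwI[where g = j'] bij_betwI[where g = j])
  \<comment> \<open>The conjugate of the action by \<open>j\<close>, restricted to the carrier
    because membership in \<open>auto N'\<close> demands extensionality.\<close>
  define \<gamma>' where "\<gamma>' g = (\<lambda>x \<in> carrier N'. j (\<gamma> (i g) (j' x)))" for g
  have "bijective_cocycle G' N' (j \<circ> \<beta> \<circ> i) \<gamma>'"
  proof unfold_locales
    show "bij_betw (j \<circ> \<beta> \<circ> i) (carrier G') (carrier N')"
      using i bij jbij by (auto simp: iso_def intro: bij_betw_trans)
    show "\<gamma>' g \<in> auto N'" if g: "g \<in> carrier G'" for g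
    proof -
      have "bij_betw (j \<circ> (\<gamma> (i g) \<circ> j')) (carrier N') (carrier N')"
        using \<gamma>_Bij[OF icl[OF g]] jbij j'bij by (auto simp: Bij_def intro: bij_betw_trans)
      then have "\<gamma>' g \<in> Bij (carrier N')"
        unfolding Bij_def \<gamma>'_def by (auto cong: bij_betw_cong)
      moreover have "\<gamma>' g \<in> hom N' N'"
        using icl[OF g] by (intro homI) (auto simp: \<gamma>'_def j'mult \<gamma>_mult jmult)
      ultimately show ?thesis by (simp add: auto_def)
    qed
    show "(j \<circ> \<beta> \<circ> i) (g \<otimes>\<^bsub>G'\<^esub> h) = (j \<circ> \<beta> \<circ> i) g \<otimes>\<^bsub>N'\<^esub> \<gamma>' g ((j \<circ> \<beta> \<circ> i) h)"
      if gh: "g \<in> carrier G'" "h \<in> carrier G'" for g h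
    proof -
      have "i (g \<otimes>\<^bsub>G'\<^esub> h) = i g \<otimes>\<^bsub>G\<^esub> i h" using i gh by (simp add: iso_def hom_def)
      then show ?thesis using gh by (simp add: icl \<beta>_mult jmult \<gamma>'_def)
    qed
  qed
  then show ?thesis using assms by (auto simp: realizable_iff_bijective_cocycle)
qed

text \<open>With \<open>\<lambda>\<^sub>b = \<theta>\<^sub>b \<circ> \<phi>\<^sub>b\<^sup>-\<^sup>1\<close>, one has \<open>(a, b) \<cdot>\<^sub>\<theta> (c, d) = (a, b) \<cdot>\<^sub>\<phi> (\<lambda>\<^sub>b c, d)\<close>.\<close>

lemma realizable_semidirect_prod:
  fixes A :: "('a, 'c) monoid_scheme" and B :: "('b, 'd) monoid_scheme"
  assumes "group A" "group B"
    and \<theta>: "\<theta> \<in> hom B (AutoGroup A)" and \<phi>: "\<phi> \<in> hom B (AutoGroup A)"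
    and comm: "\<And>\<zeta> \<eta> x. \<lbrakk>\<zeta> \<in> auto A; \<eta> \<in> auto A; x \<in> carrier A\<rbrakk> \<Longrightarrow> \<zeta> (\<eta> x) = \<eta> (\<zeta> x)"
  shows "realizable (semidirect_prod A B \<theta>) (semidirect_prod A B \<phi>)"
proof -
  interpret A: group A by fact
  interpret B: group B by fact
  let ?G = "semidirect_prod A B \<theta>" and ?N = "semidirect_prod A B \<phi>"
  have gr: "group ?G" "group ?N" using assms by (auto intro: group_semidirect_prod)
  have au: "\<psi> x \<in> auto A" if "\<psi> \<in> hom B (AutoGroup A)" "x \<in> carrier B" for \<psi> x
    using that by (auto simp: hom_def AutoGroup_def)
  have cl: "\<psi> x a \<in> carrier A"
    if "\<psi> \<in> hom B (AutoGroup A)" "x \<in> carrier B" "a \<in> carrier A" for \<psi> x a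
    using au[OF that(1,2)] that(3) by (auto simp: auto_def hom_def)
  have mu: "\<psi> x (a \<otimes>\<^bsub>A\<^esub> b) = \<psi> x a \<otimes>\<^bsub>A\<^esub> \<psi> x b"
    if "\<psi> \<in> hom B (AutoGroup A)" "x \<in> carrier B" "a \<in> carrier A" "b \<in> carrier A" for \<psi> x a b
    using au[OF that(1,2)] that(3,4) by (auto simp: auto_def hom_def)
  have inv: "\<psi> x (\<psi> (inv\<^bsub>B\<^esub> x) a) = a" "\<psi> (inv\<^bsub>B\<^esub> x) (\<psi> x a) = a"
    if "\<psi> \<in> hom B (AutoGroup A)" "x \<in> carrier B" "a \<in> carrier A" for \<psi> x a
  proof -
    have co: "\<psi> (y \<otimes>\<^bsub>B\<^esub> z) a = \<psi> y (\<psi> z a)" if "y \<in> carrier B" "z \<in> carrier B" for y z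
      using hom_mult[OF \<open>\<psi> \<in> hom B (AutoGroup A)\<close> that] au[OF \<open>\<psi> \<in> hom B (AutoGroup A)\<close>] that
        \<open>a \<in> carrier A\<close> by (auto simp: AutoGroup_def BijGroup_def auto_def compose_def)
    have "\<psi> \<one>\<^bsub>B\<^esub> a = a"
      using hom_one[OF that(1) assms(2) A.AutoGroup] that(3) by (simp add: AutoGroup_def BijGroup_def)
    then show "\<psi> x (\<psi> (inv\<^bsub>B\<^esub> x) a) = a" "\<psi> (inv\<^bsub>B\<^esub> x) (\<psi> x a) = a"
      using that(2) by (simp_all flip: co)
  qed
  define \<kappa> where "\<kappa> b c = \<theta> b (\<phi> (inv\<^bsub>B\<^esub> b) c)" for b c
  have \<kappa>cl: "\<kappa> b c \<in> carrier A" if "b \<in> carrier B" "c \<in> carrier A" for b c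
    using that by (simp add: \<kappa>_def cl \<theta> \<phi>)
  \<comment> \<open>Commuting automorphisms of \<open>A\<close> make the twist
    \<open>\<kappa> b\<close> commute with every \<open>\<phi> d\<close>; hence changing the first
    coordinate by it respects the product of \<open>?N\<close>.\<close>
  have \<kappa>\<phi>: "\<kappa> b (\<phi> d c) = \<phi> d (\<kappa> b c)" if "b \<in> carrier B" "d \<in> carrier B" "c \<in> carrier A" for b c d
    using that by (simp add: \<kappa>_def cl \<theta> \<phi> au comm[of "\<phi> d"])
  have \<phi>\<kappa>: "\<phi> b (\<kappa> b c) = \<theta> b c" if "b \<in> carrier B" "c \<in> carrier A" for b c
    using that by (simp add: \<kappa>_def cl \<theta> \<phi> au comm[of "\<phi> b" "\<theta> b"] inv)
  \<comment> \<open>Both products live on the same carrier, so the identity serves as the bijection,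
    and \<open>\<gamma>\<close> only records the twist of the first coordinate.\<close>
  define \<gamma> where "\<gamma> = (\<lambda>(a :: 'a, b). \<lambda>(c, d) \<in> carrier ?N. (\<kappa> b c, d))"
  have "bijective_cocycle ?G ?N (\<lambda>x. x) \<gamma>"
  proof (intro bijective_cocycle.intro bijective_cocycle_axioms.intro gr)
    show "bij_betw (\<lambda>x. x) (carrier ?G) (carrier ?N)"
      by (simp add: semidirect_prod_def bij_betw_def)
    fix z assume z: "z \<in> carrier ?G"
    obtain a b where ab: "z = (a, b)" "a \<in> carrier A" "b \<in> carrier B"
      using z by (auto simp: semidirect_prod_def)
    let ?g = "\<lambda>(c, d). (\<phi> b (\<theta> (inv\<^bsub>B\<^esub> b) c), d)"
    have "bij_betw (\<gamma> z) (carrier ?N) (carrier ?N)"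
      using ab by (intro bij_betwI[where g = ?g])
        (auto simp: \<gamma>_def semidirect_prod_def \<kappa>_def cl inv \<theta> \<phi>)
    moreover have "\<gamma> z \<in> hom ?N ?N"
      using ab by (intro homI) (auto simp: \<gamma>_def semidirect_prod_def \<kappa>cl cl \<phi> \<theta> mu \<kappa>\<phi>[unfolded \<kappa>_def] \<kappa>_def)
    ultimately show "\<gamma> z \<in> auto ?N" using ab by (simp add: auto_def Bij_def \<gamma>_def)
    fix w assume "w \<in> carrier ?G"
    then show "z \<otimes>\<^bsub>?G\<^esub> w = z \<otimes>\<^bsub>?N\<^esub> \<gamma> z w"
      using ab by (auto simp: \<gamma>_def semidirect_prod_def \<phi>\<kappa>)
  qed
  then show ?thesis using realizable_iff_bijective_cocycle[OF gr] by blast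
qed

subsection \<open>Fixed points and Sylow subgroups\<close>

text \<open>Orbit sizes are powers of \<open>p\<close>, so all orbits other than singletons together
  contribute a multiple of \<open>p\<close>.\<close>

lemma (in group_action) prime_dvd_card_fixed_points:
  assumes "Factorial_Ring.prime p" "order G = p ^ k" "finite E" "p dvd card E"
  shows "p dvd card {x \<in> E. \<forall>g \<in> carrier G. \<phi> g x = x}"
proof -
  let ?F = "{x \<in> E. \<forall>g \<in> carrier G. \<phi> g x = x}"
  let ?O = "orbits G E \<phi>"
  interpret G: group G using group_hom by (simp add: group_hom_def)
  have fin: "finite ?O" "\<And>A. A \<in> ?O \<Longrightarrow> finite A"
    using assms(3) orbits_coverture by (metis finite_UnionD, metis finite_subset Union_upper)
  have self: "x \<in> orbit G \<phi> x" if "x \<in> E" for x using orbit_refl[OF that] .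
  have small: "card A = 1 \<or> p dvd card A" if A: "A \<in> ?O" for A
  proof -
    obtain x where x: "x \<in> E" "A = orbit G \<phi> x" using A by (auto simp: orbits_def)
    have "card A dvd p ^ k" using orbit_stabilizer_theorem[OF x(1)] assms(2) x(2) by (metis dvd_triv_left)
    then obtain i where "card A = p ^ i" using assms(1) divides_primepow_nat by blast
    then show ?thesis by (cases i) auto
  qed
  have single: "A \<in> (\<lambda>x. {x}) ` ?F" if A: "A \<in> ?O" "card A = 1" for A
  proof -
    obtain x where x: "x \<in> E" "A = orbit G \<phi> x" using A by (auto simp: orbits_def)
    then have "A = {x}" using A(2) self by (metis card_1_singletonE singletonD)
    then have "x \<in> ?F" using x by (auto simp: orbit_def)
    with \<open>A = {x}\<close> show ?thesis by blast
  qed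
  have fixed: "{x} \<in> ?O" if "x \<in> ?F" for x
  proof -
    have "orbit G \<phi> x = {x}" using that G.one_closed by (force simp: orbit_def)
    then show ?thesis using that unfolding orbits_def by blast
  qed
  have "card E = (\<Sum>A \<in> ?O. card A)"
    using fin disjoint_union by (subst orbits_coverture[symmetric], intro card_Union_disjoint) (auto simp: pairwise_def disjnt_def)
  also have "?O = (\<lambda>x. {x}) ` ?F \<union> {A \<in> ?O. card A \<noteq> 1}"
    using single fixed by auto
  also have "sum card \<dots> = card ?F + sum card {A \<in> ?O. card A \<noteq> 1}"
    using assms(3) fin by (subst sum.union_disjoint) (auto simp: sum.reindex)
  finally have "card E = card ?F + sum card {A \<in> ?O. card A \<noteq> 1}" .
  moreover have "p dvd sum card {A \<in> ?O. card A \<noteq> 1}" using small by (intro dvd_sum) auto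
  ultimately show ?thesis using assms(4) by (simp add: dvd_add_left_iff)
qed

text \<open>Describing \<open>P\<close> by an equation shows at once that it is the only subgroup of
  its order and that every automorphism preserves it.\<close>

lemma (in group) sylow_eq_pow_eq_one:
  assumes "Factorial_Ring.prime p" "q < p" "order G = q * p ^ n" "subgroup P G" "card P = p ^ n" "0 < q"
  shows "P = {x \<in> carrier G. x [^] (p ^ n) = \<one>}"
proof (intro equalityI subsetI)
  interpret P: subgroup P G by fact
  have p: "p > 1" using assms(1) by (rule prime_gt_1_nat)
  fix x assume x: "x \<in> P"
  interpret PG: group "G\<lparr>carrier := P\<rparr>" by (rule P.subgroup_is_group) (rule is_group)
  have "x [^]\<^bsub>G\<lparr>carrier := P\<rparr>\<^esub> order (G\<lparr>carrier := P\<rparr>) = \<one>"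
    using PG.pow_order_eq_1[of x] x by simp
  then show "x \<in> {x \<in> carrier G. x [^] (p ^ n) = \<one>}"
    using x assms(5) by (simp add: order_def nat_pow_consistent[symmetric])
next
  interpret P: subgroup P G by fact
  have p: "p > 1" using assms(1) by (rule prime_gt_1_nat)
  fix x assume "x \<in> {x \<in> carrier G. x [^] (p ^ n) = \<one>}"
  then have x: "x \<in> carrier G" "x [^] (p ^ n) = \<one>" by auto
  have "card (rcosets P) * p ^ n = q * p ^ n"
    using lagrange[OF assms(4)] assms(3,5) by simp
  then have card: "card (rcosets P) = q" using p by simp
  then have fin: "finite (rcosets P)" using assms(6) by (intro card_ge_0_finite) simp
  \<comment> \<open>Two of the powers \<open>x\<^sup>0, \<dots>, x\<^sup>q\<close> lie in the same of the \<open>q\<close> cosets of \<open>P\<close>, so some \<open>x\<^sup>i\<close> with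
    \<open>0 < i < p\<close> lies in \<open>P\<close>; it generates the same subgroup as \<open>x\<close>.\<close>
  have "\<not> inj_on (\<lambda>i. P #> x [^] i) {..q}"
  proof
    assume "inj_on (\<lambda>i. P #> x [^] i) {..q}"
    then have "card {..q} \<le> card (rcosets P)"
      using x fin by (intro card_inj_on_le) (auto intro!: rcosetsI P.subset)
    then show False using card by simp
  qed
  then obtain i j where ij: "i < j" "j \<le> q" "P #> x [^] i = P #> x [^] j"
    unfolding inj_on_def by (metis atMost_iff linorder_neqE_nat)
  have "x [^] j \<otimes> inv (x [^] i) \<in> P"
    using ij(3) x P.rcos_module[OF is_group, of "x [^] i" "x [^] j"] rcos_self[OF _ assms(4), of "x [^] j"]
    by simp
  moreover have "x [^] j = x [^] (j - i) \<otimes> x [^] i" using ij x by (simp add: nat_pow_mult)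
  ultimately have mem: "x [^] (j - i) \<in> P" using x by (simp add: m_assoc)
  have ij': "0 < j - i" "j - i < p" using ij(1,2) assms(2) by auto
  then have "\<not> p dvd j - i" by (auto dest: dvd_imp_le)
  with assms(1) have "coprime p (j - i)" by (rule prime_imp_coprime_nat)
  then have "gcd (j - i) (p ^ n) = 1" by (simp add: coprime_commute)
  then obtain r s where rs: "(j - i) * r = p ^ n * s + 1"
    using ij' bezout_nat[of "j - i" "p ^ n"] by auto
  have "x [^] ((j - i) * r) = x"
    unfolding rs using x by (simp add: nat_pow_mult[symmetric] nat_pow_pow[symmetric])
  moreover have "(x [^] (j - i)) [^] r \<in> P"
    using mem by (induction r) auto
  ultimately show "x \<in> P" using x by (simp add: nat_pow_pow)
qed

text \<open>Iteration of \<open>f\<close> is an action of the cyclic group of order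
  \<open>p ^ N\<close>, whose common fixed points are those of \<open>f\<close>.\<close>

lemma prime_dvd_card_fixed_points_funpow:
  fixes f :: "'a \<Rightarrow> 'a"
  assumes p: "Factorial_Ring.prime p" and E: "finite E" "p dvd card E"
    and f: "f \<in> E \<rightarrow> E" "\<And>x. x \<in> E \<Longrightarrow> (f ^^ (p ^ N)) x = x"
  shows "p dvd card {x \<in> E. f x = x}"
proof -
  define M where "M = p ^ N"
  let ?Z = "integer_mod_group (M)"
  define \<phi> where "\<phi> i = restrict (f ^^ nat i) E" for i :: int
  have p0: "M > 0" using prime_gt_0_nat[OF p] by (simp add: M_def)
  have cl: "(f ^^ k) x \<in> E" if "x \<in> E" for k x
    using that f(1) by (induction k) auto
  have per: "(f ^^ k) x = (f ^^ (k mod M)) x" if "x \<in> E" for k x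
    using funpow_mod_eq[OF f(2)[OF that]] by (simp add: M_def)
  have carr: "carrier ?Z = {0..<int (M)}" using p0 by (simp add: carrier_integer_mod_group)
  have mult: "\<phi> (i \<otimes>\<^bsub>?Z\<^esub> j) = compose E (\<phi> i) (\<phi> j)" if "i \<in> carrier ?Z" "j \<in> carrier ?Z" for i j
  proof (rule ext)
    fix x
    have "nat ((i + j) mod int (M)) = (nat i + nat j) mod M"
      using that unfolding carr by (simp add: nat_mod_distrib nat_add_distrib)
    then show "\<phi> (i \<otimes>\<^bsub>?Z\<^esub> j) x = compose E (\<phi> i) (\<phi> j) x"
      using per[of x "nat i + nat j"] cl by (simp add: \<phi>_def compose_def funpow_add)
  qed
  have id: "\<phi> 0 = (\<lambda>x\<in>E. x)" by (auto simp: \<phi>_def)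
  have bij: "\<phi> i \<in> Bij E" if i: "i \<in> carrier ?Z" for i
  proof -
    interpret Z: group ?Z by simp
    let ?j = "inv\<^bsub>?Z\<^esub> i"
    have "compose E (\<phi> i) (\<phi> ?j) = (\<lambda>x\<in>E. x)" "compose E (\<phi> ?j) (\<phi> i) = (\<lambda>x\<in>E. x)"
      using mult[of i ?j] mult[of ?j i] i id Z.inv_closed[OF i] Z.r_inv[OF i] Z.l_inv[OF i] by simp_all
    then have "\<phi> i (\<phi> ?j x) = x" "\<phi> ?j (\<phi> i x) = x" if "x \<in> E" for x
      using that by (auto simp: compose_def dest!: fun_cong[where x = x])
    then have "bij_betw (\<phi> i) E E"
      by (intro bij_betwI[where g = "\<phi> ?j"]) (auto simp: \<phi>_def cl)
    then show ?thesis by (simp add: Bij_def \<phi>_def)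
  qed
  interpret group_action ?Z E \<phi>
  proof (unfold group_action_def group_hom_def group_hom_axioms_def, intro conjI)
    show "\<phi> \<in> hom ?Z (BijGroup E)"
      by (rule homI) (auto simp: BijGroup_def bij mult simp del: mult_integer_mod_group)
  qed (auto simp: group_BijGroup)
  have "order ?Z = p ^ N" by (simp add: order_def carr) (simp add: M_def)
  then have "p dvd card {x \<in> E. \<forall>i \<in> carrier ?Z. \<phi> i x = x}"
    using prime_dvd_card_fixed_points p E by blast
  also have "{x \<in> E. \<forall>i \<in> carrier ?Z. \<phi> i x = x} = {x \<in> E. f x = x}"
  proof (intro equalityI subsetI)
    fix x assume "x \<in> {x \<in> E. \<forall>i \<in> carrier ?Z. \<phi> i x = x}"
    then have x: "x \<in> E" "\<And>i. i \<in> carrier ?Z \<Longrightarrow> \<phi> i x = x" by auto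
    \<comment> \<open>The generator is \<open>1 mod M\<close>, which is 0 when \<open>M = 1\<close>;
      periodicity covers that case too.\<close>
    have "f x = (f ^^ (1 mod M)) x" using per[OF x(1), of 1] by simp
    also have "\<dots> = \<phi> (int (1 mod M)) x" using x(1) by (simp add: \<phi>_def)
    also have "\<dots> = x" using p0 by (intro x(2)) (simp add: carr)
    finally show "x \<in> {x \<in> E. f x = x}" using x(1) by simp
  next
    fix x assume "x \<in> {x \<in> E. f x = x}"
    then have x: "x \<in> E" "f x = x" by auto
    have "(f ^^ k) x = x" for k using x(2) by (induction k) auto
    then show "x \<in> {x \<in> E. \<forall>i \<in> carrier ?Z. \<phi> i x = x}" using x by (simp add: \<phi>_def)
  qed
  finally show ?thesis .
qed

text \<open>The fixed point count is used twice: for conjugation, giving a centre of order divisible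
  by \<open>p\<close>, and for \<open>\<zeta>\<close> on that centre. A power of a nontrivial fixed
  central element then has order \<open>p\<close>.\<close>

lemma (in group) central_fixed_element_of_prime_order:
  assumes p: "Factorial_Ring.prime p" and order: "order G = p ^ m" "m \<noteq> 0"
    and \<zeta>: "\<zeta> \<in> hom G G" "\<And>x. x \<in> carrier G \<Longrightarrow> (\<zeta> ^^ (p ^ N)) x = x"
  obtains c where "c \<in> carrier G" "c \<noteq> \<one>" "c [^] p = \<one>" "\<zeta> c = c"
    "\<And>x. x \<in> carrier G \<Longrightarrow> c \<otimes> x = x \<otimes> c"
proof -
  have p1: "p > 1" using p by (rule prime_gt_1_nat)
  have fin: "finite (carrier G)" using order p1 by (simp flip: order_gt_0_iff_finite)
  have zcl: "\<zeta> x \<in> carrier G" if "x \<in> carrier G" for x using \<zeta>(1) that by (auto simp: hom_def)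
  have zmult: "\<zeta> (x \<otimes> y) = \<zeta> x \<otimes> \<zeta> y" if "x \<in> carrier G" "y \<in> carrier G" for x y
    using \<zeta>(1) that by (auto simp: hom_def)
  have zkcl: "(\<zeta> ^^ k) x \<in> carrier G" if "x \<in> carrier G" for k x
    using that zcl by (induction k) auto
  define Z where "Z = {x \<in> carrier G. \<forall>g \<in> carrier G. g \<otimes> x = x \<otimes> g}"
  interpret conj: group_action G "carrier G" "\<lambda>g. \<lambda>h \<in> carrier G. g \<otimes> h \<otimes> inv g"
    by (rule action_by_conjugation)
  have "p dvd card (carrier G)" using order by (simp add: order_def)
  then have "p dvd card {x \<in> carrier G. \<forall>g \<in> carrier G. (\<lambda>h \<in> carrier G. g \<otimes> h \<otimes> inv g) x = x}"
    by (rule conj.prime_dvd_card_fixed_points[OF p order(1) fin])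
  also have "{x \<in> carrier G. \<forall>g \<in> carrier G. (\<lambda>h \<in> carrier G. g \<otimes> h \<otimes> inv g) x = x} = Z"
    unfolding Z_def by (intro Collect_cong conj_cong refl ball_cong) (simp add: inv_solve_right')
  finally have "p dvd card Z" .
  moreover have "finite Z" using fin by (simp add: Z_def)
  moreover have "\<zeta> \<in> Z \<rightarrow> Z"
  proof
    fix x assume x: "x \<in> Z"
    have "g \<otimes> \<zeta> x = \<zeta> x \<otimes> g" if g: "g \<in> carrier G" for g
    proof -
      \<comment> \<open>Surjectivity of \<open>\<zeta>\<close>, needed for it to preserve the
        centre: a preimage of \<open>g\<close> is its image under the iterate
        \<open>p ^ N - 1\<close>.\<close>
      have "p ^ N = Suc (p ^ N - 1)" using p1 by simp
      then have "(\<zeta> ^^ Suc (p ^ N - 1)) g = g" using \<zeta>(2)[OF g] by (simp only:)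
      then obtain h where h: "h \<in> carrier G" "\<zeta> h = g" using zkcl[OF g, of "p ^ N - 1"] by auto
      have "h \<otimes> x = x \<otimes> h" using x h by (simp add: Z_def)
      then have "\<zeta> h \<otimes> \<zeta> x = \<zeta> x \<otimes> \<zeta> h" using x h zmult[of h x] zmult[of x h] by (simp add: Z_def)
      then show ?thesis using h by simp
    qed
    then show "\<zeta> x \<in> Z" using x zcl by (simp add: Z_def)
  qed
  ultimately have dvd: "p dvd card {x \<in> Z. \<zeta> x = x}"
    by (intro prime_dvd_card_fixed_points_funpow[OF p, where N = N]) (auto simp: \<zeta>(2) Z_def)
  have "\<zeta> \<one> = \<one>" using hom_one[OF \<zeta>(1)] is_group by blast
  then have one: "\<one> \<in> {x \<in> Z. \<zeta> x = x}" by (simp add: Z_def)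
  have "{x \<in> Z. \<zeta> x = x} \<noteq> {\<one>}" using dvd p1 by auto
  then obtain x where x: "x \<in> Z" "\<zeta> x = x" "x \<noteq> \<one>" using one by blast
  have xG: "x \<in> carrier G" using x by (simp add: Z_def)
  obtain e where e: "ord x = p ^ e"
    using ord_dvd_group_order[OF xG] p order by (metis divides_primepow_nat)
  then have "e \<noteq> 0" using x(3) ord_eq_1[OF xG] by (cases e) auto
  then obtain e' where e': "e = Suc e'" by (cases e) auto
  let ?c = "x [^] (p ^ e')"
  show thesis
  proof
    show "?c \<in> carrier G" using xG by simp
    show "?c \<noteq> \<one>" using xG e e' p1 by (auto simp: pow_eq_id dest!: dvd_imp_le)
    show "?c [^] p = \<one>" using xG e e' by (simp add: nat_pow_pow pow_eq_id mult.commute)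
    show "\<zeta> ?c = ?c" using hom_nat_pow[OF \<zeta>(1) xG] x(2) is_group by simp
    show "?c \<otimes> y = y \<otimes> ?c" if "y \<in> carrier G" for y
      using x(1) that xG by (intro group_commutes_pow) (auto simp: Z_def)
  qed
qed

subsection \<open>Affine maps with a single orbit\<close>

lemma (in group) nat_pow_eq_iff_cong:
  fixes m n :: nat
  assumes "x \<in> carrier G"
  shows "x [^] m = x [^] n \<longleftrightarrow> [m = n] (mod ord x)"
  using int_pow_eq[OF assms, of "int m" "int n"]
  by (simp add: int_pow_int cong_iff_dvd_diff flip: cong_int_iff) (metis dvd_diff_commute)

text \<open>If \<open>c\<close> is not a power of \<open>a\<close>, then the group is the direct
  product of the subgroups generated by \<open>c\<close> and \<open>a\<close>. In these coordinates
  the orbit of the identity is explicit and closes up after \<open>ord a\<close> steps, so the group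
  has at most \<open>ord a\<close> elements and \<open>a\<close> generates it.\<close>

lemma (in group) cyclic_orbit_central_extension:
  fixes p N m :: nat
  assumes p: "Factorial_Ring.prime p" "odd p" and order: "order G = p ^ m"
    and \<zeta>: "\<zeta> \<in> hom G G" "\<And>x. x \<in> carrier G \<Longrightarrow> (\<zeta> ^^ (p ^ N)) x = x"
    and a: "a \<in> carrier G"
    and orbit: "\<And>x. x \<in> carrier G \<Longrightarrow> \<exists>k. x = ((\<lambda>y. a \<otimes> \<zeta> y) ^^ k) \<one>"
    and c: "c \<in> carrier G" "c [^] p = \<one>" "\<zeta> c = c" "\<And>x. x \<in> carrier G \<Longrightarrow> c \<otimes> x = x \<otimes> c"
    and gen: "\<And>x. x \<in> carrier G \<Longrightarrow> \<exists>(j::nat) (i::nat). x = c [^] j \<otimes> a [^] i"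
    and x: "x \<in> carrier G"
  shows "\<exists>i::nat. x = a [^] i"
proof (cases "\<exists>i::nat. c = a [^] i")
  case True
  then show ?thesis using gen[OF x] a by (metis nat_pow_mult nat_pow_pow)
next
  case False
  have p1: "p > 1" using p(1) by (rule prime_gt_1_nat)
  have fin: "finite (carrier G)" using order p1 by (simp flip: order_gt_0_iff_finite)
  have comm: "x \<otimes> y = y \<otimes> x" if "x \<in> carrier G" "y \<in> carrier G" for x y
  proof -
    obtain j i :: nat where xy1: "x = c [^] j \<otimes> a [^] i" using gen[OF \<open>x \<in> carrier G\<close>] by blast
    obtain l k :: nat where xy2: "y = c [^] l \<otimes> a [^] k" using gen[OF \<open>y \<in> carrier G\<close>] by blast
    have cj: "c [^] j \<otimes> z = z \<otimes> c [^] j" if "z \<in> carrier G" for z and j :: nat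
      using group_commutes_pow[OF c(4)[OF that] c(1) that] by simp
    have "c [^] j \<otimes> a [^] i \<otimes> (c [^] l \<otimes> a [^] k) = c [^] (j + l) \<otimes> a [^] (i + k)"
      for j i l k :: nat
    proof -
      have "c [^] j \<otimes> a [^] i \<otimes> (c [^] l \<otimes> a [^] k) = c [^] j \<otimes> (a [^] i \<otimes> c [^] l) \<otimes> a [^] k"
        using a c(1) by (simp add: m_assoc)
      also have "\<dots> = (c [^] j \<otimes> c [^] l) \<otimes> (a [^] i \<otimes> a [^] k)"
        using a c(1) by (simp only: cj[of "a [^] i" l, symmetric] nat_pow_closed) (simp add: m_assoc)
      finally show ?thesis using a c(1) by (simp add: nat_pow_mult)
    qed
    then show ?thesis unfolding xy1 xy2 by (simp add: add.commute)
  qed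
  interpret comm_group G by (rule group.group_comm_groupI[OF is_group comm])
  have zcl [simp]: "\<zeta> x \<in> carrier G" if "x \<in> carrier G" for x using \<zeta>(1) that by (auto simp: hom_def)
  have zmult: "\<zeta> (x \<otimes> y) = \<zeta> x \<otimes> \<zeta> y" if "x \<in> carrier G" "y \<in> carrier G" for x y
    using \<zeta>(1) that by (auto simp: hom_def)
  have zpow: "\<zeta> (x [^] (k::nat)) = \<zeta> x [^] k" if "x \<in> carrier G" for x k
    using hom_nat_pow[OF \<zeta>(1)] that is_group by blast
  \<comment> \<open>The subgroups generated by \<open>c\<close> and \<open>a\<close> meet trivially:
    a nontrivial power of \<open>c\<close> has \<open>c\<close> among its own powers, since
    \<open>ord c\<close> divides the prime \<open>p\<close>.\<close>
  have triv: "c [^] j = \<one>" if ji: "c [^] j = a [^] i" for i j :: nat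
  proof (rule ccontr)
    assume "c [^] j \<noteq> \<one>"
    have "\<not> p dvd j"
    proof
      assume "p dvd j"
      then obtain r where "j = p * r" by blast
      then have "c [^] j = \<one>" using c(1,2) by (metis nat_pow_one nat_pow_pow)
      with \<open>c [^] j \<noteq> \<one>\<close> show False by simp
    qed
    then have "coprime j p" using p(1) prime_imp_coprime_nat by (metis coprime_commute)
    then obtain r where r: "[j * r = 1] (mod p)" using cong_solve_coprime_nat by auto
    have "ord c dvd p" using c by (simp add: pow_eq_id)
    then have "[j * r = 1] (mod ord c)" using r cong_dvd_modulus_nat by blast
    then have "c [^] (j * r) = c [^] (1::nat)" using c by (simp only: nat_pow_eq_iff_cong)
    then have "c = (c [^] j) [^] r" using c by (simp add: nat_pow_pow)
    then have "c = a [^] (i * r)" using ji a by (simp add: nat_pow_pow)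
    with False show False by blast
  qed
  obtain s where s: "ord a = p ^ s"
    using ord_dvd_group_order[OF a] p(1) order by (metis divides_primepow_nat)
  obtain d u :: nat where du: "\<zeta> a = c [^] d \<otimes> a [^] u" using gen[OF zcl[OF a]] by blast
  \<comment> \<open>\<open>S k\<close> is the exponent of \<open>a\<close> after \<open>k\<close>
    steps of the affine map; the exponent of \<open>c\<close> accumulates \<open>d\<close> times the
    earlier values of \<open>S\<close>.\<close>
  define S where "S k = (\<Sum>i<k. u ^ i)" for k
  have S_Suc: "S (Suc k) = 1 + u * S k" for k
    unfolding S_def by (subst sum.lessThan_Suc_shift) (simp add: sum_distrib_left)
  have orb: "((\<lambda>y. a \<otimes> \<zeta> y) ^^ k) \<one> = c [^] (d * (\<Sum>j<k. S j)) \<otimes> a [^] S k" for k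
  proof (induction k)
    case 0
    then show ?case by (simp add: S_def)
  next
    case (Suc k)
    have "((\<lambda>y. a \<otimes> \<zeta> y) ^^ Suc k) \<one> = a \<otimes> \<zeta> (c [^] (d * (\<Sum>j<k. S j)) \<otimes> a [^] S k)"
      using Suc by simp
    also have "\<dots> = a \<otimes> (c [^] (d * (\<Sum>j<k. S j)) \<otimes> (c [^] (d * S k) \<otimes> a [^] (u * S k)))"
      using a c by (simp add: zmult zpow du nat_pow_distrib nat_pow_pow)
    also have "\<dots> = c [^] (d * (\<Sum>j<Suc k. S j)) \<otimes> a [^] S (Suc k)"
      using a c by (simp add: S_Suc algebra_simps flip: nat_pow_mult) (simp add: m_ac)
    finally show ?case .
  qed
  have zk: "(\<zeta> ^^ k) a = c [^] (d * S k) \<otimes> a [^] (u ^ k)" for k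
  proof (induction k)
    case 0
    then show ?case using a by (simp add: S_def)
  next
    case (Suc k)
    have "(\<zeta> ^^ Suc k) a = \<zeta> (c [^] (d * S k) \<otimes> a [^] (u ^ k))" using Suc by simp
    also have "\<dots> = c [^] (d * S k) \<otimes> (c [^] (d * u ^ k) \<otimes> a [^] (u * u ^ k))"
      using a c by (simp add: zmult zpow du nat_pow_distrib nat_pow_pow)
    also have "\<dots> = c [^] (d * S (Suc k)) \<otimes> a [^] (u ^ Suc k)"
      using a c by (simp add: S_def algebra_simps flip: nat_pow_mult) (simp add: m_ac)
    finally show ?case .
  qed
  have "s \<noteq> 0"
  proof
    assume "s = 0"
    then have "a = \<one>" using s a by (simp add: ord_eq_1[symmetric])
    have "\<zeta> \<one> = \<one>" using hom_one[OF \<zeta>(1)] is_group by blast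
    then have "((\<lambda>y. a \<otimes> \<zeta> y) ^^ k) \<one> = \<one>" for k using \<open>a = \<one>\<close> by (induction k) auto
    then have "c = a [^] (0::nat)" using orbit[OF c(1)] by simp
    with False show False by blast
  qed
  have u1: "[u = 1] (mod p)"
  proof -
    let ?U = "u ^ (p ^ N)" and ?J = "d * S (p ^ N)"
    have e: "a = c [^] ?J \<otimes> a [^] ?U" using \<zeta>(2)[OF a] zk by simp
    \<comment> \<open>Solves \<open>e\<close> for the power of \<open>c\<close>: multiplying by
      \<open>a [^] (?U * (ord a - 1))\<close> replaces division by \<open>a [^] ?U\<close>, as
      exponents are natural numbers. The power of \<open>c\<close> is thus a power of
      \<open>a\<close>, hence trivial by \<open>triv\<close>.\<close>
    have "a [^] (1 + ?U * (ord a - 1)) = a \<otimes> a [^] (?U * (ord a - 1))"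
      using a by (simp add: m_comm)
    also have "\<dots> = (c [^] ?J \<otimes> a [^] ?U) \<otimes> a [^] (?U * (ord a - 1))"
      using e by simp
    also have "\<dots> = c [^] ?J \<otimes> a [^] (?U + ?U * (ord a - 1))"
      using a c by (simp add: m_assoc nat_pow_mult)
    also have "?U + ?U * (ord a - 1) = ord a * ?U"
      using s p1 by (simp add: algebra_simps)
    also have "a [^] (ord a * ?U) = \<one>" using a by (simp add: nat_pow_pow[symmetric])
    finally have "c [^] ?J = a [^] (1 + ?U * (ord a - 1))" using c(1) by simp
    then have "c [^] ?J = \<one>" by (rule triv)
    then have "a [^] ?U = a [^] (1::nat)" using a e by simp
    then have "[?U = 1] (mod p ^ s)" using a s by (simp only: nat_pow_eq_iff_cong)
    then have "[?U = 1] (mod p)" using \<open>s \<noteq> 0\<close> by (meson cong_dvd_modulus_nat dvd_power neq0_conv)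
    then show ?thesis using cong_power_prime_power[OF p(1)] cong_sym cong_trans by blast
  qed
  have Scong: "[S k = k] (mod p)" for k
  proof -
    have "[S k = (\<Sum>i<k. 1 ^ i)] (mod p)" unfolding S_def by (intro cong_sum cong_pow u1)
    then show ?thesis by simp
  qed
  \<comment> \<open>Since \<open>S j\<close> is congruent to \<open>j\<close>, the exponent of
    \<open>c\<close> after \<open>p ^ s\<close> steps is \<open>d\<close> times
    \<open>0 + ... + (p ^ s - 1)\<close> modulo \<open>p\<close>, which vanishes for odd
    \<open>p\<close>.\<close>
  have "[(\<Sum>j<p ^ s. S j) = (\<Sum>j<p ^ s. j)] (mod p)" by (intro cong_sum Scong)
  moreover have "p dvd (\<Sum>j<p ^ s. j)"
    using odd_sum_lessThan[of "p ^ s"] p(2) \<open>s \<noteq> 0\<close> by (simp add: dvd_mult2)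
  ultimately have "p dvd (\<Sum>j<p ^ s. S j)" using cong_dvd_iff by blast
  then obtain r where "(\<Sum>j<p ^ s. S j) = p * r" by blast
  then have "d * (\<Sum>j<p ^ s. S j) = p * (d * r)" by simp
  then have "c [^] (d * (\<Sum>j<p ^ s. S j)) = (c [^] p) [^] (d * r)"
    by (simp only: nat_pow_pow[OF c(1)])
  then have c1: "c [^] (d * (\<Sum>j<p ^ s. S j)) = \<one>" using c by simp
  have "a [^] S (p ^ s) = \<one>"
    using geometric_sum_prime_power(1)[OF p u1] a s by (simp add: S_def pow_eq_id)
  then have period: "((\<lambda>y. a \<otimes> \<zeta> y) ^^ (p ^ s)) \<one> = \<one>" unfolding orb c1 by simp
  have "carrier G \<subseteq> (\<lambda>k. ((\<lambda>y. a \<otimes> \<zeta> y) ^^ k) \<one>) ` {..<p ^ s}"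
  proof
    fix x assume "x \<in> carrier G"
    then obtain k where "x = ((\<lambda>y. a \<otimes> \<zeta> y) ^^ k) \<one>" using orbit by blast
    then have "x = ((\<lambda>y. a \<otimes> \<zeta> y) ^^ (k mod p ^ s)) \<one>" using funpow_mod_eq[OF period] by simp
    then show "x \<in> (\<lambda>k. ((\<lambda>y. a \<otimes> \<zeta> y) ^^ k) \<one>) ` {..<p ^ s}" using p1 by auto
  qed
  then have "card (carrier G) \<le> p ^ s" using surj_card_le[of "{..<p ^ s}"] by simp
  then have "card (carrier G) \<le> card (generate G {a})" using generate_pow_card[OF a] s by simp
  moreover have "generate G {a} \<subseteq> carrier G" using a by (intro generate_incl) simp
  ultimately have "generate G {a} = carrier G" using fin by (intro card_seteq)
  then show ?thesis using x generate_pow_on_finite_carrier[OF fin a] by blast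
qed

text \<open>For invariant normal \<open>K\<close> the claim is that \<open>K\<close> and the powers
  of \<open>a\<close> fill the group. If this holds for the preimage \<open>L\<close> of the
  subgroup generated by a central fixed element \<open>c\<close> of order \<open>p\<close> in the
  quotient by \<open>K\<close>, then \<open>c\<close> and the image of \<open>a\<close> generate
  that quotient, and the preceding lemma removes \<open>c\<close>. The case of trivial
  \<open>K\<close> is the goal.\<close>

lemma (in group) cyclic_if_cyclic_affine_orbit:
  fixes p n N :: nat
  assumes p: "Factorial_Ring.prime p" "odd p" and order: "order G = p ^ n"
    and \<zeta>: "\<zeta> \<in> hom G G" "\<And>x. x \<in> carrier G \<Longrightarrow> (\<zeta> ^^ (p ^ N)) x = x"
    and a: "a \<in> carrier G"
    and orbit: "\<And>x. x \<in> carrier G \<Longrightarrow> \<exists>k. x = ((\<lambda>y. a \<otimes> \<zeta> y) ^^ k) \<one>"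
    and x: "x \<in> carrier G"
  shows "\<exists>i::nat. x = a [^] i"
proof -
  note mult_FactGroup [simp del] one_FactGroup [simp del]
  have p1: "p > 1" using p(1) by (rule prime_gt_1_nat)
  have fin: "finite (carrier G)" using order p1 by (simp flip: order_gt_0_iff_finite)
  have zcl: "\<zeta> x \<in> carrier G" if "x \<in> carrier G" for x using \<zeta>(1) that by (auto simp: hom_def)
  have zmult: "\<zeta> (x \<otimes> y) = \<zeta> x \<otimes> \<zeta> y" if "x \<in> carrier G" "y \<in> carrier G" for x y
    using \<zeta>(1) that by (auto simp: hom_def)
  \<comment> \<open>Induction on the index of \<open>K\<close> rather than on the order of the group, since the quotient
    \<open>G Mod K\<close> lives on another type.\<close>
  have "\<forall>x \<in> carrier G. \<exists>i::nat. \<exists>k \<in> K. x = k \<otimes> a [^] i" if "K \<lhd> G" "\<zeta> ` K \<subseteq> K" for K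
    using that
  proof (induction "card (carrier G) - card K" arbitrary: K rule: less_induct)
    case (less K)
    interpret K: normal K G by fact
    show ?case
    proof (cases "K = carrier G")
      case True
      then show ?thesis by (auto intro!: exI[of _ "0::nat"])
    next
      case False
      let ?R = "G Mod K"
      define \<pi> where "\<pi> x = K #> x" for x
      interpret R: group ?R by (rule K.factorgroup_is_group)
      have \<pi>hom: "\<pi> \<in> hom G ?R" unfolding \<pi>_def by (rule K.r_coset_hom_Mod)
      interpret \<pi>: group_hom G ?R \<pi> by unfold_locales (rule \<pi>hom)
      have surj: "carrier ?R = \<pi> ` carrier G" by (simp add: carrier_FactGroup \<pi>_def)
      have \<pi>_eq: "\<pi> x = \<pi> y \<longleftrightarrow> x \<otimes> inv y \<in> K" if "x \<in> carrier G" "y \<in> carrier G" for x y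
        using K.rcos_module[OF is_group that(2,1)] that repr_independence[OF _ that(2) K.subgroup_axioms, of x]
          rcos_self[OF that(1) K.subgroup_axioms] unfolding \<pi>_def by auto
      have "order ?R * card K = p ^ n"
        using lagrange[OF K.subgroup_axioms] order by (simp add: order_def FactGroup_def)
      then obtain m where m: "order ?R = p ^ m"
        using p(1) by (metis divides_primepow_nat dvd_triv_left)
      have "m \<noteq> 0"
      proof
        assume "m = 0"
        then have "card K = card (carrier G)"
          using \<open>order ?R * card K = p ^ n\<close> m order by (simp add: order_def)
        then show False using False K.subset fin card_subset_eq by blast
      qed
      have \<zeta>hom: "\<pi> \<circ> \<zeta> \<in> hom G ?R" using \<zeta>(1) \<pi>hom by (rule Group.hom_compose)
      \<comment> \<open>Invariance of \<open>K\<close> makes \<open>\<pi> \<circ> \<zeta>\<close>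
        constant on cosets, so \<open>\<zeta>\<close> descends to the quotient.\<close>
      have wd: "(\<pi> \<circ> \<zeta>) x = (\<pi> \<circ> \<zeta>) y"
        if xy: "x \<in> carrier G" "y \<in> carrier G" "K #> x = K #> y" for x y
      proof -
        have "x \<otimes> inv y \<in> K" using \<pi>_eq[OF xy(1,2)] xy(3) by (simp add: \<pi>_def)
        then have "\<pi> (\<zeta> ((x \<otimes> inv y) \<otimes> y)) = \<pi> (\<zeta> (x \<otimes> inv y)) \<otimes>\<^bsub>?R\<^esub> \<pi> (\<zeta> y)"
          using xy by (simp add: zmult zcl)
        moreover have "\<pi> (\<zeta> (x \<otimes> inv y)) = \<one>\<^bsub>?R\<^esub>"
          using \<open>x \<otimes> inv y \<in> K\<close> less.prems(2) by (auto simp: \<pi>_def one_FactGroup intro!: K.rcos_const[OF is_group])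
        ultimately show ?thesis using xy by (simp add: m_assoc zcl)
      qed
      have "\<exists>\<zeta>R. \<zeta>R \<in> hom ?R ?R \<and> (\<forall>x \<in> carrier G. \<zeta>R (K #> x) = (\<pi> \<circ> \<zeta>) x)"
        by (rule FactGroup_universal[OF \<zeta>hom less.prems(1)], rule wd, assumption+, blast)
      then obtain \<zeta>R where \<zeta>R: "\<zeta>R \<in> hom ?R ?R"
        "\<And>x. x \<in> carrier G \<Longrightarrow> \<zeta>R (K #> x) = (\<pi> \<circ> \<zeta>) x"
        by blast
      then have \<zeta>R_\<pi>: "\<zeta>R (\<pi> x) = \<pi> (\<zeta> x)" if "x \<in> carrier G" for x
        using that by (simp add: \<pi>_def)
      have zkcl: "(\<zeta> ^^ k) x \<in> carrier G" if "x \<in> carrier G" for k x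
        using that zcl by (induction k) auto
      have "(\<zeta>R ^^ k) (\<pi> x) = \<pi> ((\<zeta> ^^ k) x)" if "x \<in> carrier G" for k x
        by (induction k) (simp_all add: \<zeta>R_\<pi> zkcl that)
      then have per: "(\<zeta>R ^^ (p ^ N)) u = u" if "u \<in> carrier ?R" for u
        using that \<zeta>(2) unfolding surj by auto
      obtain c where c: "c \<in> carrier ?R" "c \<noteq> \<one>\<^bsub>?R\<^esub>" "c [^]\<^bsub>?R\<^esub> p = \<one>\<^bsub>?R\<^esub>" "\<zeta>R c = c"
        "\<And>u. u \<in> carrier ?R \<Longrightarrow> c \<otimes>\<^bsub>?R\<^esub> u = u \<otimes>\<^bsub>?R\<^esub> c"
        using R.central_fixed_element_of_prime_order[OF p(1) m \<open>m \<noteq> 0\<close> \<zeta>R(1) per] by blast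
      have cpow: "c [^]\<^bsub>?R\<^esub> j \<otimes>\<^bsub>?R\<^esub> u = u \<otimes>\<^bsub>?R\<^esub> c [^]\<^bsub>?R\<^esub> j" if "u \<in> carrier ?R" for u and j :: nat
        using R.group_commutes_pow[OF c(5)[OF that] c(1) that] .
      define L where "L = {x \<in> carrier G. \<exists>j::nat. \<pi> x = c [^]\<^bsub>?R\<^esub> j}"
      have LI: "x \<in> L" if "x \<in> carrier G" "\<pi> x = c [^]\<^bsub>?R\<^esub> j" for x and j :: nat
        using that unfolding L_def by blast
      have L_one: "x \<in> L" if "x \<in> carrier G" "\<pi> x = \<one>\<^bsub>?R\<^esub>" for x
        using that by (intro LI[of x 0]) simp_all
      have finR: "finite (carrier ?R)" using fin unfolding surj by simp
      \<comment> \<open>By finiteness the natural powers of \<open>c\<close> already form a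
        subgroup; this yields the inverses in \<open>L\<close>.\<close>
      have cgen: "generate ?R {c} = {c [^]\<^bsub>?R\<^esub> j | j. j \<in> (UNIV :: nat set)}"
        by (rule R.generate_pow_on_finite_carrier[OF finR c(1)])
      have "subgroup L G"
      proof (rule subgroupI)
        show "L \<subseteq> carrier G" by (auto simp: L_def)
        have "\<one> \<in> L" by (rule L_one) simp_all
        then show "L \<noteq> {}" by blast
        show "x \<otimes> y \<in> L" if xy: "x \<in> L" "y \<in> L" for x y
        proof -
          obtain i j :: nat where "\<pi> x = c [^]\<^bsub>?R\<^esub> i" "\<pi> y = c [^]\<^bsub>?R\<^esub> j"
            using xy by (auto simp: L_def)
          then have "\<pi> (x \<otimes> y) = c [^]\<^bsub>?R\<^esub> (i + j)"
            using xy c(1) by (simp add: L_def R.nat_pow_mult)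
          then show ?thesis using xy unfolding L_def by blast
        qed
        show "inv x \<in> L" if "x \<in> L" for x
        proof -
          have "inv\<^bsub>?R\<^esub> \<pi> x \<in> generate ?R {c}"
            using that c(1) cgen by (intro subgroup.m_inv_closed R.generate_is_subgroup) (auto simp: L_def)
          then have "\<exists>j::nat. \<pi> (inv x) = c [^]\<^bsub>?R\<^esub> j"
            using that unfolding cgen by (simp add: L_def)
          then show ?thesis using that by (simp add: L_def)
        qed
      qed
      moreover have "x \<otimes> h \<otimes> inv x \<in> L" if xh: "x \<in> carrier G" "h \<in> L" for x h
      proof -
        from xh obtain j :: nat where h: "h \<in> carrier G" "\<pi> h = c [^]\<^bsub>?R\<^esub> j" by (auto simp: L_def)
        have "\<pi> (x \<otimes> h \<otimes> inv x) = \<pi> x \<otimes>\<^bsub>?R\<^esub> c [^]\<^bsub>?R\<^esub> j \<otimes>\<^bsub>?R\<^esub> inv\<^bsub>?R\<^esub> \<pi> x"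
          using xh h by simp
        also have "\<dots> = c [^]\<^bsub>?R\<^esub> j \<otimes>\<^bsub>?R\<^esub> \<pi> x \<otimes>\<^bsub>?R\<^esub> inv\<^bsub>?R\<^esub> \<pi> x"
          using xh by (simp only: cpow \<pi>.hom_closed)
        also have "\<dots> = c [^]\<^bsub>?R\<^esub> j" using xh c(1) by (simp add: R.m_assoc)
        finally have "\<exists>i::nat. \<pi> (x \<otimes> h \<otimes> inv x) = c [^]\<^bsub>?R\<^esub> i" by blast
        then show ?thesis using xh h by (simp only: L_def mem_Collect_eq) simp
      qed
      ultimately have "L \<lhd> G" by (rule normal_invI)
      moreover have "\<zeta> ` L \<subseteq> L"
      proof
        fix y assume "y \<in> \<zeta> ` L"
        then obtain x and j :: nat where x: "x \<in> carrier G" "y = \<zeta> x" "\<pi> x = c [^]\<^bsub>?R\<^esub> j"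
          by (auto simp: L_def)
        have "\<zeta>R (\<pi> x) = c [^]\<^bsub>?R\<^esub> j"
          unfolding x(3) using hom_nat_pow[OF \<zeta>R(1) c(1) R.is_group R.is_group] c(4) by simp
        then have "\<pi> y = c [^]\<^bsub>?R\<^esub> j" using x(1,2) \<zeta>R_\<pi> by simp
        then show "y \<in> L" using x(1,2) zcl by (auto simp: L_def)
      qed
      moreover have "K \<subset> L"
      proof -
        obtain x where x: "x \<in> carrier G" "c = \<pi> x" using c(1) unfolding surj by blast
        then have "x \<in> L" using c(1) by (intro LI[of x 1]) simp_all
        moreover have "x \<notin> K"
          using c(2) x K.rcos_const[OF is_group, of x] by (auto simp: \<pi>_def one_FactGroup)
        moreover have "K \<subseteq> L"
          using L_one K.rcos_const[OF is_group] K.subset by (auto simp: \<pi>_def one_FactGroup)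
        ultimately show ?thesis by blast
      qed
      moreover have "L \<subseteq> carrier G" by (auto simp: L_def)
      ultimately have L: "\<forall>x \<in> carrier G. \<exists>i::nat. \<exists>k \<in> L. x = k \<otimes> a [^] i"
      proof (intro less.hyps)
        assume "K \<subset> L" "L \<subseteq> carrier G"
        then have "card K < card L" "card L \<le> card (carrier G)"
          using fin by (auto intro: psubset_card_mono card_mono finite_subset)
        then show "card (carrier G) - card L < card (carrier G) - card K" by simp
      qed auto
      have gen: "\<exists>(j::nat) (i::nat). u = c [^]\<^bsub>?R\<^esub> j \<otimes>\<^bsub>?R\<^esub> \<pi> a [^]\<^bsub>?R\<^esub> i"
        if "u \<in> carrier ?R" for u
      proof -
        obtain x where x: "x \<in> carrier G" "u = \<pi> x" using \<open>u \<in> carrier ?R\<close> unfolding surj by blast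
        then obtain k and i :: nat where k: "k \<in> L" "x = k \<otimes> a [^] i" using L by blast
        then have "u = \<pi> k \<otimes>\<^bsub>?R\<^esub> \<pi> a [^]\<^bsub>?R\<^esub> i"
          using x a by (simp add: L_def \<pi>.hom_nat_pow)
        moreover obtain j :: nat where "\<pi> k = c [^]\<^bsub>?R\<^esub> j" using k(1) by (auto simp: L_def)
        ultimately have "u = c [^]\<^bsub>?R\<^esub> j \<otimes>\<^bsub>?R\<^esub> \<pi> a [^]\<^bsub>?R\<^esub> i" by simp
        then show ?thesis by blast
      qed
      have orbit_cl: "((\<lambda>y. a \<otimes> \<zeta> y) ^^ k) \<one> \<in> carrier G" for k
        using a zcl by (induction k) auto
      have orbit_\<pi>: "((\<lambda>Y. \<pi> a \<otimes>\<^bsub>?R\<^esub> \<zeta>R Y) ^^ k) \<one>\<^bsub>?R\<^esub> = \<pi> (((\<lambda>y. a \<otimes> \<zeta> y) ^^ k) \<one>)" for k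
        using a by (induction k) (simp_all add: \<zeta>R_\<pi> orbit_cl zcl)
      have orbR: "\<exists>k. u = ((\<lambda>Y. \<pi> a \<otimes>\<^bsub>?R\<^esub> \<zeta>R Y) ^^ k) \<one>\<^bsub>?R\<^esub>" if "u \<in> carrier ?R" for u
      proof -
        obtain x where x: "x \<in> carrier G" "u = \<pi> x"
          using \<open>u \<in> carrier ?R\<close> unfolding surj by blast
        from orbit[OF x(1)] obtain k where "x = ((\<lambda>y. a \<otimes> \<zeta> y) ^^ k) \<one>" ..
        then have "u = ((\<lambda>Y. \<pi> a \<otimes>\<^bsub>?R\<^esub> \<zeta>R Y) ^^ k) \<one>\<^bsub>?R\<^esub>"
          unfolding x(2) orbit_\<pi> by (rule arg_cong)
        then show ?thesis by (rule exI)
      qed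
      show ?thesis
      proof
        fix x assume x: "x \<in> carrier G"
        have "\<exists>i::nat. \<pi> x = \<pi> a [^]\<^bsub>?R\<^esub> i"
          by (rule R.cyclic_orbit_central_extension[OF p m \<zeta>R(1) per _ orbR c(1,3,4,5) gen])
            (use a x in auto)
        then obtain i :: nat where "\<pi> x = \<pi> (a [^] i)" using a by (auto simp: \<pi>.hom_nat_pow)
        then have "x \<otimes> inv (a [^] i) \<in> K" using \<pi>_eq x a by simp
        moreover have "x = x \<otimes> inv (a [^] i) \<otimes> a [^] i" using x a by (simp add: m_assoc)
        ultimately show "\<exists>i::nat. \<exists>k \<in> K. x = k \<otimes> a [^] i" by blast
      qed
    qed
  qed
  from this[OF one_is_normal] have "\<forall>x \<in> carrier G. \<exists>i::nat. x = \<one> \<otimes> a [^] i"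
    using hom_one[OF \<zeta>(1) is_group is_group] by simp
  then show ?thesis using x a by auto
qed

subsection \<open>Cyclic semidirect products\<close>

text \<open>An automorphism is multiplication by the image of the generator, which is written
  \<open>1 mod int k\<close> so that \<open>k = 1\<close> is included.\<close>

lemma auto_integer_mod_group:
  assumes "\<zeta> \<in> auto (integer_mod_group k)" "x \<in> carrier (integer_mod_group k)" "0 < k"
  shows "\<zeta> x = (\<zeta> (1 mod int k) * x) mod int k"
proof -
  let ?Z = "integer_mod_group k"
  have hom: "\<zeta> \<in> hom ?Z ?Z" using assms(1) by (simp add: auto_def)
  have x: "0 \<le> x" "x < int k" using assms(2,3) by (auto simp: carrier_integer_mod_group)
  have one: "1 mod int k \<in> carrier ?Z" using assms(3) by (simp add: carrier_integer_mod_group)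
  have "x = (1 mod int k) [^]\<^bsub>?Z\<^esub> nat x"
    using x by (simp add: mod_mult_right_eq)
  then have "\<zeta> x = \<zeta> ((1 mod int k) [^]\<^bsub>?Z\<^esub> nat x)" by (rule arg_cong)
  also have "\<dots> = \<zeta> (1 mod int k) [^]\<^bsub>?Z\<^esub> nat x"
    by (rule hom_nat_pow[OF hom one]) auto
  also have "\<dots> = (\<zeta> (1 mod int k) * x) mod int k"
    using x by (simp add: mult.commute)
  finally show ?thesis .
qed

text \<open>Multiplications commute. This supplies the commutation hypothesis of
  \<open>realizable_semidirect_prod\<close>.\<close>

lemma auto_integer_mod_group_commute:
  assumes "\<zeta> \<in> auto (integer_mod_group k)" "\<eta> \<in> auto (integer_mod_group k)"
    "x \<in> carrier (integer_mod_group k)" "0 < k"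
  shows "\<zeta> (\<eta> x) = \<eta> (\<zeta> x)"
proof -
  have cl: "\<zeta> x \<in> carrier (integer_mod_group k)" "\<eta> x \<in> carrier (integer_mod_group k)"
    using assms(1-3) by (auto simp: auto_def hom_def)
  let ?u = "\<zeta> (1 mod int k)" and ?v = "\<eta> (1 mod int k)"
  have "\<zeta> (\<eta> x) = (?u * ((?v * x) mod int k)) mod int k"
    using auto_integer_mod_group[OF assms(1) cl(2) assms(4)] auto_integer_mod_group[OF assms(2,3,4)] by simp
  also have "\<dots> = (?v * ((?u * x) mod int k)) mod int k" by (simp add: mod_mult_right_eq mult_ac)
  also have "\<dots> = \<eta> (\<zeta> x)"
    using auto_integer_mod_group[OF assms(2) cl(1) assms(4)] auto_integer_mod_group[OF assms(1,3,4)] by simp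
  finally show ?thesis .
qed

text \<open>In a semidirect product the generator of the first factor has order
  \<open>p ^ n\<close>. Conversely \<open>c\<close> generates the Sylow \<open>p\<close>-subgroup,
  which is normal, and an element \<open>y\<close> of order \<open>q\<close> generates a
  complement.\<close>

lemma (in group) is_cyclic_semidirect_iff:
  assumes p: "Factorial_Ring.prime p" and q: "Factorial_Ring.prime q" "q < p"
    and order: "order G = q * p ^ n"
  shows "is_cyclic_semidirect (p ^ n) q G \<longleftrightarrow> (\<exists>c \<in> carrier G. ord c = p ^ n)"
proof
  let ?P = "integer_mod_group (p ^ n)" and ?Q = "integer_mod_group q"
  have p1: "p > 1" "p ^ n > 0" using prime_gt_1_nat[OF p] by auto
  have q1: "q > 1" using prime_gt_1_nat[OF q(1)] .
  {
    assume "is_cyclic_semidirect (p ^ n) q G"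
    then obtain \<theta> where \<theta>: "\<theta> \<in> hom ?Q (AutoGroup ?P)" "G \<cong> semidirect_prod ?P ?Q \<theta>"
      by (auto simp: is_cyclic_semidirect_def)
    let ?S = "semidirect_prod ?P ?Q \<theta>"
    interpret S: group ?S by (rule group_semidirect_prod) (auto simp: \<theta>)
    obtain f where f: "f \<in> iso ?S G" using \<theta>(2) iso_sym unfolding is_iso_def by blast
    interpret f: group_hom ?S G f
      using f is_group S.is_group by (auto simp: group_hom_def group_hom_axioms_def iso_def)
    have inj: "inj_on f (carrier ?S)" using f by (auto simp: iso_def bij_betw_def)
    have id: "\<theta> 0 x = x" if "x \<in> carrier ?P" for x
      using hom_one[OF \<theta>(1) _ group.AutoGroup] that by (simp add: AutoGroup_def BijGroup_def)
    let ?c = "(1 mod int (p ^ n), 0 :: int)"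
    have c: "?c \<in> carrier ?S"
      using p1 by (simp add: semidirect_prod_def carrier_integer_mod_group)
    have pow: "?c [^]\<^bsub>?S\<^esub> k = (int k mod int (p ^ n), 0)" for k
    proof (induction k)
      case 0
      then show ?case by (simp add: semidirect_prod_def nat_pow_def)
    next
      case (Suc k)
      then show ?case using c
        by (simp add: semidirect_prod_def id mod_add_eq add.commute)
    qed
    have "f ?c [^] k = \<one> \<longleftrightarrow> p ^ n dvd k" for k
    proof -
      have "f ?c [^] k = f (?c [^]\<^bsub>?S\<^esub> k)" using c by (simp add: f.hom_nat_pow)
      also have "\<dots> = \<one> \<longleftrightarrow> ?c [^]\<^bsub>?S\<^esub> k = \<one>\<^bsub>?S\<^esub>"
        using inj c f.hom_one by (metis S.nat_pow_closed S.one_closed inj_onD)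
      also have "\<dots> \<longleftrightarrow> int k mod int (p ^ n) = 0"
        unfolding pow by (simp add: semidirect_prod_def)
      also have "\<dots> \<longleftrightarrow> p ^ n dvd k" by (simp flip: of_nat_mod add: mod_eq_0_iff_dvd del: of_nat_power)
      finally show ?thesis .
    qed
    then have "ord (f ?c) = p ^ n" using ord_unique[OF f.hom_closed[OF c]] by blast
    then show "\<exists>c \<in> carrier G. ord c = p ^ n" using f.hom_closed[OF c] by blast
  }
  assume "\<exists>c \<in> carrier G. ord c = p ^ n"
  then obtain c where c: "c \<in> carrier G" "ord c = p ^ n" by blast
  have fin: "finite (carrier G)" using order p1 q1 by (simp flip: order_gt_0_iff_finite)
  obtain H where H: "subgroup H G" "card H = q ^ 1"
    using sylow_thm[OF q(1) is_group _ fin, of 1 "p ^ n"] order by auto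
  interpret H: subgroup H G by fact
  have "\<exists>y \<in> H. y \<noteq> \<one>"
  proof (rule ccontr)
    assume "\<not> ?thesis"
    then have "H \<subseteq> {\<one>}" by blast
    then have "card H \<le> 1" using card_mono[of "{\<one>}" H] by simp
    then show False using H(2) q1 by simp
  qed
  then obtain y where y: "y \<in> H" "y \<noteq> \<one>" by blast
  have yG: "y \<in> carrier G" using y by simp
  interpret XH: group "G\<lparr>carrier := H\<rparr>" by (rule H.subgroup_is_group) (rule is_group)
  have "y [^] q = \<one>"
    using XH.pow_order_eq_1[of y] y(1) H(2) by (simp add: order_def nat_pow_consistent[symmetric])
  then have "ord y dvd q" using yG by (simp add: pow_eq_id)
  then have ordy: "ord y = q" using q(1) y(2) ord_eq_1[OF yG] unfolding prime_nat_iff by auto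
  have cpow: "c [^] i = c [^] j \<longleftrightarrow> [i = j] (mod p ^ n)" for i j :: nat
    using nat_pow_eq_iff_cong[OF c(1)] c(2) by simp
  have ypow: "y [^] i = y [^] j \<longleftrightarrow> [i = j] (mod q)" for i j :: nat
    using nat_pow_eq_iff_cong[OF yG] ordy by simp
  let ?C = "generate G {c}"
  have C: "subgroup ?C G" "card ?C = p ^ n"
    using c(1) by (simp add: generate_is_subgroup, metis c generate_pow_card)
  have Ceq: "?C = {x \<in> carrier G. x [^] (p ^ n) = \<one>}"
    using sylow_eq_pow_eq_one[OF p q(2) order C] q1 by simp
  have Cpow: "\<exists>i::nat. x = c [^] i" if "x \<in> carrier G" "x [^] (p ^ n) = \<one>" for x
    using that generate_pow_on_finite_carrier[OF fin c(1)] Ceq by auto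
  have conj: "(y \<otimes> x \<otimes> inv y) [^] (k::nat) = y \<otimes> x [^] k \<otimes> inv y"
    if "x \<in> carrier G" for x k
  proof (induction k)
    case (Suc k)
    have "inv y \<otimes> (y \<otimes> (x \<otimes> inv y)) = x \<otimes> inv y"
      using that yG by (simp flip: m_assoc)
    with Suc show ?case using that yG by (simp add: m_assoc)
  qed (use yG in simp)
  \<comment> \<open>The conjugate of \<open>c\<close> satisfies the equation that cuts out the
    subgroup generated by \<open>c\<close>, so it is a power of \<open>c\<close>.\<close>
  obtain u :: nat where u: "y \<otimes> c \<otimes> inv y = c [^] u"
  proof -
    have "(y \<otimes> c \<otimes> inv y) [^] (p ^ n) = \<one>"
      using c yG by (simp only: conj pow_eq_id[of c "p ^ n"]) (metis dvd_refl pow_eq_id r_inv r_one)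
    then show thesis using Cpow[of "y \<otimes> c \<otimes> inv y"] c yG that by auto
  qed
  have yc: "y [^] j \<otimes> c [^] i = c [^] (i * u ^ j) \<otimes> y [^] j" for i j :: nat
  proof (induction j arbitrary: i)
    case (Suc j)
    have "y \<otimes> c [^] i \<otimes> inv y = c [^] (i * u)"
      using conj[OF c(1), of i] u c by (simp add: nat_pow_pow mult.commute)
    then have "y \<otimes> c [^] i = c [^] (i * u) \<otimes> y"
      using c yG by (metis inv_solve_right' m_closed nat_pow_closed)
    then have "y [^] Suc j \<otimes> c [^] i = (y [^] j \<otimes> c [^] (i * u)) \<otimes> y"
      using c yG by (simp add: m_assoc)
    then show ?case using c yG by (simp add: Suc m_assoc mult_ac)
  qed (use c yG in simp)
  \<comment> \<open>From \<open>y [^] q = \<one>\<close>; it makes \<open>u ^ j\<close> modulo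
    \<open>p ^ n\<close> depend only on \<open>j\<close> modulo \<open>q\<close>, so that
    \<open>\<theta>\<close> is a homomorphism.\<close>
  have uq: "[u ^ q = 1] (mod p ^ n)"
  proof -
    have "c [^] (1::nat) = c [^] (u ^ q)" using yc[of q 1] c yG \<open>y [^] q = \<one>\<close> by simp
    then show ?thesis using cpow cong_sym by blast
  qed
  have uper: "[u ^ (j mod q) = u ^ j] (mod p ^ n)" for j
  proof -
    have "[(u ^ q) ^ (j div q) * u ^ (j mod q) = 1 ^ (j div q) * u ^ (j mod q)] (mod p ^ n)"
      by (intro cong_mult cong_pow uq cong_refl)
    then show ?thesis by (simp flip: power_mult power_add add: cong_sym)
  qed
  define \<theta> where "\<theta> j = (\<lambda>i \<in> carrier ?P. (i * int u ^ nat j) mod int (p ^ n))" for j :: int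
  define f where "f = (\<lambda>(i, j). c [^] nat i \<otimes> y [^] nat j)"
  have carP: "carrier ?P = {0..<int (p ^ n)}" and carQ: "carrier ?Q = {0..<int q}"
    using p1 q1 by (simp_all add: carrier_integer_mod_group)
  have \<theta>cl: "\<theta> j i \<in> carrier ?P" if "i \<in> carrier ?P" for i j
    using that p1 by (simp add: \<theta>_def carP del: of_nat_power)
  have \<theta>mult: "\<theta> (j \<otimes>\<^bsub>?Q\<^esub> k) = compose (carrier ?P) (\<theta> j) (\<theta> k)"
    if "j \<in> carrier ?Q" "k \<in> carrier ?Q" for j k
  proof (rule ext)
    fix i
    have "nat ((j + k) mod int q) = (nat j + nat k) mod q"
      using that unfolding carQ by (simp add: nat_mod_distrib nat_add_distrib)
    moreover have "[int (u ^ ((nat j + nat k) mod q)) = int (u ^ (nat j + nat k))] (mod int (p ^ n))"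
      using uper by (simp only: cong_int_iff)
    then have "[i * int u ^ ((nat j + nat k) mod q) = i * int u ^ (nat j + nat k)] (mod int (p ^ n))"
      by (intro cong_mult cong_refl) simp
    then have "[i * int u ^ ((nat j + nat k) mod q) = i * int u ^ nat k * int u ^ nat j] (mod int (p ^ n))"
      by (simp add: power_add mult_ac)
    then have "(i * int u ^ ((nat j + nat k) mod q)) mod int (p ^ n)
        = ((i * int u ^ nat k) mod int (p ^ n) * int u ^ nat j) mod int (p ^ n)"
      by (simp only: cong_def mod_mult_left_eq)
    ultimately show "\<theta> (j \<otimes>\<^bsub>?Q\<^esub> k) i = compose (carrier ?P) (\<theta> j) (\<theta> k) i"
      using \<theta>cl[of i k] by (simp add: \<theta>_def compose_def del: of_nat_power)
  qed
  have \<theta>0: "\<theta> 0 = (\<lambda>i \<in> carrier ?P. i)"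
    unfolding \<theta>_def by (rule restrict_ext) (simp add: carP del: of_nat_power)
  have \<theta>bij: "\<theta> j \<in> Bij (carrier ?P)" if j: "j \<in> carrier ?Q" for j
  proof -
    interpret Q: group ?Q by simp
    let ?k = "inv\<^bsub>?Q\<^esub> j"
    have "compose (carrier ?P) (\<theta> j) (\<theta> ?k) = (\<lambda>x\<in>carrier ?P. x)"
         "compose (carrier ?P) (\<theta> ?k) (\<theta> j) = (\<lambda>x\<in>carrier ?P. x)"
      using \<theta>mult[of j ?k] \<theta>mult[of ?k j] j \<theta>0 Q.inv_closed[OF j] Q.r_inv[OF j] Q.l_inv[OF j] by simp_all
    then have "\<theta> j (\<theta> ?k x) = x" "\<theta> ?k (\<theta> j x) = x" if "x \<in> carrier ?P" for x
      using that by (auto simp: compose_def dest!: fun_cong[where x = x])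
    then have "bij_betw (\<theta> j) (carrier ?P) (carrier ?P)"
      by (intro bij_betwI[where g = "\<theta> ?k"]) (auto simp: \<theta>cl)
    then show ?thesis by (simp add: Bij_def \<theta>_def)
  qed
  have \<theta>auto: "\<theta> j \<in> auto ?P" if j: "j \<in> carrier ?Q" for j
  proof -
    have "\<theta> j (x \<otimes>\<^bsub>?P\<^esub> z) = \<theta> j x \<otimes>\<^bsub>?P\<^esub> \<theta> j z" if "x \<in> carrier ?P" "z \<in> carrier ?P" for x z
      using that group.is_monoid[OF group_integer_mod_group, THEN monoid.m_closed, OF that]
      by (simp add: \<theta>_def mod_mult_left_eq mod_add_eq distrib_right del: of_nat_power)
    then have "\<theta> j \<in> hom ?P ?P" by (intro homI) (auto simp: \<theta>cl)
    then show ?thesis using \<theta>bij[OF j] by (simp add: auto_def)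
  qed
  have \<theta>hom: "\<theta> \<in> hom ?Q (AutoGroup ?P)"
    by (rule homI) (simp_all add: AutoGroup_def BijGroup_def \<theta>auto \<theta>bij \<theta>mult del: mult_integer_mod_group)
  let ?S = "semidirect_prod ?P ?Q \<theta>"
  interpret S: group ?S by (rule group_semidirect_prod) (auto simp: \<theta>hom)
  have carS: "carrier ?S = carrier ?P \<times> carrier ?Q" by (simp add: semidirect_prod_def)
  have fhom: "f \<in> hom ?S G"
  proof (rule homI)
    fix z assume "z \<in> carrier ?S"
    then show "f z \<in> carrier G" using c yG by (cases z) (simp add: f_def)
  next
    fix z w assume zw: "z \<in> carrier ?S" "w \<in> carrier ?S"
    obtain i j i' j' where e: "z = (i, j)" "w = (i', j')" by force
    have r: "0 \<le> i" "0 \<le> i'" "0 \<le> j" "0 \<le> j'" using zw e by (auto simp: carS carP carQ)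
    have "f (z \<otimes>\<^bsub>?S\<^esub> w) = c [^] nat ((i + (i' * int u ^ nat j) mod int (p ^ n)) mod int (p ^ n))
        \<otimes> y [^] nat ((j + j') mod int q)"
      using zw e by (simp add: f_def semidirect_prod_def \<theta>_def carP)
    also have "c [^] nat ((i + (i' * int u ^ nat j) mod int (p ^ n)) mod int (p ^ n))
        = c [^] (nat i + nat i' * u ^ nat j)"
    proof -
      have "(i + (i' * int u ^ nat j) mod int (p ^ n)) mod int (p ^ n)
          = int ((nat i + nat i' * u ^ nat j) mod p ^ n)"
        unfolding of_nat_mod using r by (simp add: mod_add_right_eq)
      then show ?thesis by (simp only: cpow nat_int) (simp add: cong_def)
    qed
    also have "y [^] nat ((j + j') mod int q) = y [^] (nat j + nat j')"
    proof -
      have "(j + j') mod int q = int ((nat j + nat j') mod q)"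
        unfolding of_nat_mod using r by simp
      then show ?thesis by (simp only: ypow nat_int) (simp add: cong_def)
    qed
    also have "c [^] (nat i + nat i' * u ^ nat j) \<otimes> y [^] (nat j + nat j')
        = c [^] nat i \<otimes> (c [^] (nat i' * u ^ nat j) \<otimes> y [^] nat j) \<otimes> y [^] nat j'"
      using c yG by (simp add: m_assoc flip: nat_pow_mult)
    also have "\<dots> = f z \<otimes> f w"
      unfolding yc[symmetric] using c yG e by (simp add: f_def m_assoc)
    finally show "f (z \<otimes>\<^bsub>?S\<^esub> w) = f z \<otimes> f w" .
  qed
  interpret f: group_hom ?S G f by (simp add: group_hom_def group_hom_axioms_def fhom S.is_group is_group)
  \<comment> \<open>An element in both factors has order dividing both \<open>q\<close> and
    \<open>p ^ n\<close>, so the kernel of \<open>f\<close> is trivial; counting then gives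
    surjectivity.\<close>
  have "z = \<one>\<^bsub>?S\<^esub>" if z: "z \<in> carrier ?S" "f z = \<one>" for z
  proof -
    obtain i j where e: "z = (i, j)" by force
    have ij: "0 \<le> i" "i < int (p ^ n)" "0 \<le> j" "j < int q" using z(1) e by (auto simp: carS carP carQ)
    have e1: "c [^] nat i \<otimes> y [^] nat j = \<one>" using z(2) e by (simp add: f_def)
    have cC: "c [^] nat i \<in> ?C" using generate_pow_on_finite_carrier[OF fin c(1)] by blast
    have "y [^] nat j = inv (c [^] nat i)"
      using e1 c yG by (metis inv_equality inv_inv nat_pow_closed)
    then have "y [^] nat j \<in> ?C" using cC C(1) by (simp add: subgroup.m_inv_closed)
    then have "y [^] (nat j * p ^ n) = \<one>" using Ceq yG by (simp add: nat_pow_pow)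
    then have "q dvd nat j * p ^ n" using yG ordy by (simp add: pow_eq_id)
    moreover have "\<not> q dvd p ^ n"
      using p q by (metis less_irrefl prime_dvd_power primes_dvd_imp_eq)
    ultimately have "q dvd nat j" using q(1) prime_dvd_mult_iff by blast
    then have j0: "j = 0" using ij by (auto dest!: dvd_imp_le)
    then have "p ^ n dvd nat i" using e1 c by (simp add: pow_eq_id)
    then have "i = 0" using ij by (auto dest!: dvd_imp_le simp: nat_le_iff le_nat_iff)
    with j0 show ?thesis by (simp add: e semidirect_prod_def)
  qed
  then have inj: "inj_on f (carrier ?S)" by (simp add: f.inj_on_one_iff)
  have "card (carrier ?S) = card (carrier G)"
    using order by (simp add: carS carP carQ card_cartesian_product order_def del: of_nat_power)
  then have "f ` carrier ?S = carrier G"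
    using card_image[OF inj] fin by (intro card_seteq) auto
  then have "f \<in> iso ?S G" using fhom inj by (simp add: iso_def bij_betw_def)
  then have "G \<cong> ?S" using S.iso_sym is_isoI by blast
  then show "is_cyclic_semidirect (p ^ n) q G"
    unfolding is_cyclic_semidirect_def using \<theta>hom by blast
qed

subsection \<open>Realizability\<close>

text \<open>The Sylow \<open>p\<close>-subgroup of \<open>N\<close> is preserved by all
  \<open>\<gamma> g\<close>, so its preimage is a subgroup of \<open>G\<close> of the same order,
  that is, the Sylow \<open>p\<close>-subgroup of \<open>G\<close>. Both are given by the equation
  in the statement.\<close>

lemma (in bijective_cocycle) \<beta>_pow_eq_one_iff:
  assumes p: "Factorial_Ring.prime p" and q: "0 < q" "q < p"
    and order: "order G = q * p ^ n" "order N = q * p ^ n" and g: "g \<in> carrier G"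
  shows "\<beta> g [^]\<^bsub>N\<^esub> (p ^ n) = \<one>\<^bsub>N\<^esub> \<longleftrightarrow> g [^] (p ^ n) = \<one>"
proof -
  have p0: "p > 0" using prime_gt_0_nat[OF p] .
  have fin: "finite (carrier N)" using order p0 q by (simp flip: N.order_gt_0_iff_finite)
  obtain P where P: "subgroup P N" "card P = p ^ n"
    using sylow_thm[OF p N.is_group _ fin, of n q] order by (auto simp: mult.commute)
  have Peq: "P = {x \<in> carrier N. x [^]\<^bsub>N\<^esub> (p ^ n) = \<one>\<^bsub>N\<^esub>}"
    by (rule N.sylow_eq_pow_eq_one[OF p q(2) order(2) P q(1)])
  have inv: "\<gamma> g x \<in> P" if "g \<in> carrier G" "x \<in> P" for g x
    using that unfolding Peq by (simp flip: \<gamma>_pow)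
  have "{g \<in> carrier G. \<beta> g \<in> P} = {g \<in> carrier G. g [^] (p ^ n) = \<one>}"
    by (rule G.sylow_eq_pow_eq_one[OF p q(2) order(1) subgroup_\<beta>_vimage(1)[OF P(1) inv] _ q(1)])
      (use subgroup_\<beta>_vimage(2)[OF P(1) inv] P(2) in auto)
  then have "\<beta> g \<in> P \<longleftrightarrow> g [^] (p ^ n) = \<one>" using g by blast
  then show ?thesis using g by (simp add: Peq)
qed

text \<open>The subgroup generated by \<open>c\<close> is the Sylow \<open>p\<close>-subgroup, so it
  contains every solution of the equation.\<close>

lemma (in group) ord_eq_prime_power_imp_pow_generates:
  assumes p: "Factorial_Ring.prime p" and q: "0 < q" "q < p" and order: "order G = q * p ^ n"
    and c: "c \<in> carrier G" "ord c = p ^ n" and x: "x \<in> carrier G" "x [^] (p ^ n) = \<one>"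
  obtains i :: nat where "x = c [^] i"
proof -
  have "finite (carrier G)"
    using order q prime_gt_0_nat[OF p] by (simp flip: order_gt_0_iff_finite)
  then have gen: "generate G {c} = {c [^] i | i. i \<in> (UNIV :: nat set)}"
    using generate_pow_on_finite_carrier c(1) by blast
  have "subgroup (generate G {c}) G" using c(1) by (intro generate_is_subgroup) simp
  moreover have "card (generate G {c}) = p ^ n" using c generate_pow_card by simp
  ultimately have "generate G {c} = {x \<in> carrier G. x [^] (p ^ n) = \<one>}"
    using q by (intro sylow_eq_pow_eq_one[OF p q(2) order])
  then show thesis using x gen that by auto
qed

text \<open>For \<open>g\<close> over \<open>c\<close>, the powers of \<open>g\<close> correspond to
  powers of \<open>c\<close> with geometric sums as exponents. A smaller order of \<open>g\<close>
  would force \<open>p ^ n\<close> to divide such a sum of \<open>p ^ (n - 1)\<close> terms.\<close>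

lemma (in bijective_cocycle) ord_prime_power_domain:
  assumes p: "Factorial_Ring.prime p" "odd p" and q: "0 < q" "q < p" and n: "n \<noteq> 0"
    and order: "order G = q * p ^ n" "order N = q * p ^ n"
    and c: "c \<in> carrier N" "N.ord c = p ^ n"
  shows "\<exists>g \<in> carrier G. G.ord g = p ^ n"
proof -
  have p1: "p > 1" using prime_gt_1_nat[OF p(1)] .
  obtain g where g: "g \<in> carrier G" "c = \<beta> g" using \<beta>_surj c(1) by blast
  have cpn: "c [^]\<^bsub>N\<^esub> (p ^ n) = \<one>\<^bsub>N\<^esub>" using c by (simp add: N.pow_eq_id)
  have gpn: "g [^] (p ^ n) = \<one>"
    using \<beta>_pow_eq_one_iff[OF p(1) q order g(1)] cpn g(2) by simp
  have "\<gamma> g c [^]\<^bsub>N\<^esub> (p ^ n) = \<one>\<^bsub>N\<^esub>" using g(1) c(1) cpn by (simp flip: \<gamma>_pow)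
  then obtain u :: nat where u: "\<gamma> g c = c [^]\<^bsub>N\<^esub> u"
    using N.ord_eq_prime_power_imp_pow_generates[OF p(1) q order(2) c, of "\<gamma> g c"] g(1) c(1) by auto
  have "(\<gamma> g ^^ k) c = c [^]\<^bsub>N\<^esub> (u ^ k)" for k
    by (induction k) (use g(1) c(1) in \<open>simp_all add: \<gamma>_pow u N.nat_pow_pow\<close>)
  \<comment> \<open>Because \<open>g [^] (p ^ n)\<close> is the identity it fixes \<open>c\<close>;
    this constrains \<open>u\<close> first modulo \<open>p ^ n\<close>, then, as \<open>n\<close> is
    nonzero, modulo \<open>p\<close>.\<close>
  then have "c [^]\<^bsub>N\<^esub> (u ^ (p ^ n)) = c [^]\<^bsub>N\<^esub> (1 :: nat)"
    using \<gamma>_nat_pow[OF g(1) c(1), of "p ^ n"] gpn \<gamma>_at_one c(1) by simp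
  then have "[u ^ (p ^ n) = 1] (mod p ^ n)"
    using c(2) by (simp only: N.nat_pow_eq_iff_cong[OF c(1)])
  then have "[u ^ (p ^ n) = 1] (mod p)" using n by (meson cong_dvd_modulus_nat dvd_power neq0_conv)
  then have u1: "[u = 1] (mod p)" using cong_power_prime_power[OF p(1)] cong_sym cong_trans by blast
  have pow: "\<beta> (g [^] k) = c [^]\<^bsub>N\<^esub> (\<Sum>i<k. u ^ i)" for k :: nat
  proof (induction k)
    case (Suc k)
    have "\<beta> (g [^] Suc k) = c \<otimes>\<^bsub>N\<^esub> \<gamma> g (c [^]\<^bsub>N\<^esub> (\<Sum>i<k. u ^ i))"
      unfolding Suc[symmetric] \<beta>_nat_pow[OF g(1)] by (simp add: g(2))
    also have "\<dots> = c [^]\<^bsub>N\<^esub> Suc (u * (\<Sum>i<k. u ^ i))"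
      using g(1) c(1) N.nat_pow_Suc2[OF c(1)] by (simp add: \<gamma>_pow u N.nat_pow_pow)
    also have "Suc (u * (\<Sum>i<k. u ^ i)) = (\<Sum>i<Suc k. u ^ i)"
      by (subst sum.lessThan_Suc_shift) (simp add: sum_distrib_left)
    finally show ?case .
  qed simp
  obtain i where i: "G.ord g = p ^ i" "i \<le> n"
    using gpn g(1) by (auto simp: G.pow_eq_id divides_primepow_nat[OF p(1)])
  have "\<not> i \<le> n - 1"
  proof
    assume "i \<le> n - 1"
    then have "g [^] (p ^ (n - 1)) = \<one>" using i g(1) by (simp add: G.pow_eq_id le_imp_power_dvd)
    then have "c [^]\<^bsub>N\<^esub> (\<Sum>i<p ^ (n - 1). u ^ i) = \<one>\<^bsub>N\<^esub>" using pow[of "p ^ (n - 1)"] by simp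
    then have "p ^ n dvd (\<Sum>i<p ^ (n - 1). u ^ i)" using c by (simp add: N.pow_eq_id)
    then show False using geometric_sum_prime_power(2)[OF p u1, of "n - 1"] n by simp
  qed
  then have "i = n" using i(2) by linarith
  then have "G.ord g = p ^ n" using i(1) by simp
  then show ?thesis using g(1) by blast
qed

text \<open>The elements of \<open>G\<close> over the Sylow subgroup \<open>P\<close> of
  \<open>N\<close> are the powers of \<open>g\<close>. Hence \<open>P\<close> is a single orbit of
  the affine map given by \<open>\<beta> g\<close> and \<open>\<gamma> g\<close>, and
  \<open>\<beta> g\<close> generates it.\<close>

lemma (in bijective_cocycle) ord_prime_power_codomain:
  assumes p: "Factorial_Ring.prime p" "odd p" and q: "0 < q" "q < p"
    and order: "order G = q * p ^ n" "order N = q * p ^ n"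
    and g: "g \<in> carrier G" "G.ord g = p ^ n"
  shows "N.ord (\<beta> g) = p ^ n"
proof -
  have p0: "p > 0" using prime_gt_0_nat[OF p(1)] .
  have fin: "finite (carrier N)" using order p0 q by (simp flip: N.order_gt_0_iff_finite)
  have gpn: "g [^] (p ^ n) = \<one>" using g by (simp add: G.pow_eq_id)
  have apn: "\<beta> g [^]\<^bsub>N\<^esub> (p ^ n) = \<one>\<^bsub>N\<^esub>"
    using \<beta>_pow_eq_one_iff[OF p(1) q order g(1)] gpn by simp
  obtain P where P: "subgroup P N" "card P = p ^ n"
    using sylow_thm[OF p(1) N.is_group _ fin, of n q] order by (auto simp: mult.commute)
  have Peq: "P = {x \<in> carrier N. x [^]\<^bsub>N\<^esub> (p ^ n) = \<one>\<^bsub>N\<^esub>}"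
    by (rule N.sylow_eq_pow_eq_one[OF p(1) q(2) order(2) P q(1)])
  have P_pow: "x [^]\<^bsub>N\<^esub> (p ^ n) = \<one>\<^bsub>N\<^esub>" if "x \<in> P" for x
    using that by (simp add: Peq)
  have \<beta>P: "\<beta> g \<in> P" using apn g(1) by (simp add: Peq)
  have \<gamma>P: "\<gamma> g x \<in> P" if "x \<in> P" for x
  proof -
    have "x \<in> carrier N" "x [^]\<^bsub>N\<^esub> (p ^ n) = \<one>\<^bsub>N\<^esub>" using that by (simp_all add: Peq)
    then show ?thesis using g(1) \<gamma>_pow[of g x "p ^ n"] by (simp add: Peq)
  qed
  interpret P: subgroup P N by fact
  let ?P = "N\<lparr>carrier := P\<rparr>"
  interpret PG: group ?P by (rule P.subgroup_is_group) (rule N.is_group)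
  have "\<exists>i::nat. x = \<beta> g [^]\<^bsub>?P\<^esub> i" if x: "x \<in> P" for x
  proof (rule PG.cyclic_if_cyclic_affine_orbit[OF p, where \<zeta> = "\<gamma> g" and N = n])
    show "order ?P = p ^ n" using P(2) by (simp add: order_def)
    show "\<gamma> g \<in> hom ?P ?P" using g(1) \<gamma>P by (intro homI) (simp_all add: \<gamma>_mult)
    show "(\<gamma> g ^^ (p ^ n)) y = y" if "y \<in> carrier ?P" for y
      using that \<gamma>_nat_pow[OF g(1), of y "p ^ n"] gpn \<gamma>_at_one[of y] by simp
    show "\<exists>k. y = ((\<lambda>z. \<beta> g \<otimes>\<^bsub>?P\<^esub> \<gamma> g z) ^^ k) \<one>\<^bsub>?P\<^esub>" if "y \<in> carrier ?P" for y
    proof -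
      have y: "y \<in> P" using that by simp
      obtain h where h: "h \<in> carrier G" "y = \<beta> h" by (rule \<beta>_surj[OF P.mem_carrier[OF y]])
      have hpn: "h [^] (p ^ n) = \<one>"
        using y unfolding h(2) by (intro \<beta>_pow_eq_one_iff[OF p(1) q order h(1), THEN iffD1] P_pow)
      obtain k :: nat where "h = g [^] k"
        by (rule G.ord_eq_prime_power_imp_pow_generates[OF p(1) q order(1) g h(1) hpn])
      then have "y = ((\<lambda>z. \<beta> g \<otimes>\<^bsub>?P\<^esub> \<gamma> g z) ^^ k) \<one>\<^bsub>?P\<^esub>"
        using h(2) \<beta>_nat_pow[OF g(1)] by simp
      then show ?thesis by blast
    qed
  qed (use \<beta>P x in simp_all)
  then have "P \<subseteq> generate N {\<beta> g}"
    using N.generate_pow_on_finite_carrier[OF fin, of "\<beta> g"] g(1)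
    by (auto simp flip: N.nat_pow_consistent)
  moreover have "generate N {\<beta> g} \<subseteq> P" using \<beta>P P(1) by (intro N.generate_subgroup_incl) simp_all
  ultimately have "generate N {\<beta> g} = P" by blast
  then show ?thesis using N.generate_pow_card[of "\<beta> g"] g(1) P(2) by simp
qed

text \<open>Transport from the concrete products, where the twist construction applies because
  automorphisms of a cyclic group commute.\<close>

lemma realizable_if_cyclic_semidirect:
  assumes "group G" "group N" "0 < k"
    and "is_cyclic_semidirect k m G" "is_cyclic_semidirect k m N"
  shows "realizable G N"
proof -
  let ?A = "integer_mod_group k" and ?B = "integer_mod_group m"
  obtain \<theta> \<phi> where \<theta>: "\<theta> \<in> hom ?B (AutoGroup ?A)" "G \<cong> semidirect_prod ?A ?B \<theta>"
    and \<phi>: "\<phi> \<in> hom ?B (AutoGroup ?A)" "N \<cong> semidirect_prod ?A ?B \<phi>"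
    using assms(4,5) unfolding is_cyclic_semidirect_def by blast
  have gr: "group (semidirect_prod ?A ?B \<theta>)" "group (semidirect_prod ?A ?B \<phi>)"
    using \<theta>(1) \<phi>(1) by (auto intro: group_semidirect_prod)
  have "realizable (semidirect_prod ?A ?B \<theta>) (semidirect_prod ?A ?B \<phi>)"
    using \<theta>(1) \<phi>(1) assms(3)
    by (intro realizable_semidirect_prod) (auto intro: auto_integer_mod_group_commute)
  then show ?thesis
    using realizable_iso[OF gr assms(1,2)] group.iso_sym[OF assms(1) \<theta>(2)]
      group.iso_sym[OF assms(2) \<phi>(2)] by blast
qed

theorem theorem5p5:
  fixes n p q :: nat
    and G :: "('a, 'c) monoid_scheme"
    and N :: "('b, 'd) monoid_scheme"
  assumes "n \<ge> 1"
    and "Factorial_Ring.prime p" "odd p" "Factorial_Ring.prime q" "odd q" "q < p"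
    and "group G" "is_cyclic_semidirect (p ^ n) q G"
    and "group N" "order N = q * p ^ n"
  shows "(realizable G N \<longleftrightarrow> is_cyclic_semidirect (p ^ n) q N) \<and>
         (realizable N G \<longleftrightarrow> is_cyclic_semidirect (p ^ n) q N)"
proof -
  have pq: "0 < q" "0 < p ^ n" using prime_gt_0_nat assms(2,4) by auto
  have order: "order G = q * p ^ n"
  proof -
    obtain \<theta> where "G \<cong> semidirect_prod (integer_mod_group (p ^ n)) (integer_mod_group q) \<theta>"
      using assms(8) unfolding is_cyclic_semidirect_def by blast
    then have "order G = card (carrier (integer_mod_group (p ^ n)) \<times> carrier (integer_mod_group q))"
      unfolding order_def by (drule_tac iso_same_card) (simp add: semidirect_prod_def)
    then show ?thesis using pq
      by (simp add: carrier_integer_mod_group card_cartesian_product del: of_nat_power)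
  qed
  note iff = group.is_cyclic_semidirect_iff[OF _ assms(2,4,6)]
  obtain g where g: "g \<in> carrier G" "group.ord G g = p ^ n"
    using iff[OF assms(7) order] assms(8) by blast
  have "is_cyclic_semidirect (p ^ n) q N" if real: "realizable G N"
  proof -
    obtain \<beta> \<gamma> where "bijective_cocycle G N \<beta> \<gamma>"
      using real realizable_iff_bijective_cocycle[OF assms(7,9)] by blast
    then interpret bijective_cocycle G N \<beta> \<gamma> .
    show ?thesis
      using ord_prime_power_codomain[OF assms(2,3) pq(1) assms(6) order assms(10) g] g(1)
        iff[OF assms(9,10)] \<beta>_closed by blast
  qed
  \<comment> \<open>The roles are exchanged: \<open>G\<close> is now the additive group, so the
    element of order \<open>p ^ n\<close> is pulled back to \<open>N\<close> instead of being pushed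
    forward.\<close>
  moreover have "is_cyclic_semidirect (p ^ n) q N" if real: "realizable N G"
  proof -
    obtain \<beta> \<gamma> where "bijective_cocycle N G \<beta> \<gamma>"
      using real realizable_iff_bijective_cocycle[OF assms(9,7)] by blast
    then interpret bijective_cocycle N G \<beta> \<gamma> .
    show ?thesis
      using ord_prime_power_domain[OF assms(2,3) pq(1) assms(6) _ assms(10) order g] assms(1)
        iff[OF assms(9,10)] by simp
  qed
  moreover have "realizable G N" "realizable N G" if "is_cyclic_semidirect (p ^ n) q N"
    using realizable_if_cyclic_semidirect pq(2) assms(7-9) that by blast+
  ultimately show ?thesis by blast
qed

end
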